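(* There exist absolute constants $c\in(0,1)$, $c'>0$ (the parameters of the class $\Theta_A$) and $c_1,c_2,c_3>0$ such that the following holds. Let $n,N,p,K,\tau$ be positive integers with $n\ge K\ge\tau>1$, $\tau\le c_1N$ and $pK\le c_2\,nN$, and let $i\in\{1,\dots,n\}$. Let $d$ be a metric on $\Delta_p$ such that, for some $0<c_d\le C_d<\infty$, $c_d\|u-v\|_1\le2d(u,v)\le C_d\|u-v\|_1$ for all $u,v\in\Delta_p$. Then, for every $A_0\in\Theta_A$, $$\inf_{\widehat{\boldsymbol\alpha}}\ \sup\ \mathbb{E}\bigl[W(\widehat{\boldsymbol\alpha},\boldsymbol\alpha;d)\bigr]\ \ge\ c_3\,c_d\,\overline\kappa_\tau(A_0)\left(\sqrt{\frac{\tau}{N}}+\frac1{\overline\kappa_\tau(A_0)}\sqrt{\frac{pK}{nN}}\right)$$ (the right-hand side being read as $c_3c_d\bigl(\overline\kappa_\tau(A_0)\sqrt{\tau/N}+\sqrt{pK/(nN)}\bigr)$), where $\boldsymbol\alpha=\boldsymbol\alpha^{(i)}$ is the mixing measure of document $i$, the infimum is over all estimators $\widehat{\boldsymbol\alpha}$ (probability measures on $\Delta_p$ depending measurably on the data $Y^{(1)},\dots,Y^{(n)}$), and the supremum is over all topic models with $A\in\Theta_A$ and $\alpha=\alpha^{(i)}\in\Theta_\alpha(\tau)$.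
   Context: $\Delta_m$ is the probability simplex in $\mathbb{R}^m$; $\|\cdot\|_0$ counts nonzero entries. Topic model: one observes independent $Y^{(\ell)}\sim\mathrm{Multinomial}_p(N,r^{(\ell)})$, $\ell=1,\dots,n$, with $r^{(\ell)}=A\alpha^{(\ell)}$, where $A=[A_1,\dots,A_K]\in\mathbb{R}^{p\times K}$ has columns $A_k\in\Delta_p$ (rows are denoted $A_{j\cdot}$), $\alpha^{(\ell)}\in\Delta_K$, and $[\alpha^{(1)},\dots,\alpha^{(n)}]$ has rank $K$. The mixing measure of document $\ell$ is $\boldsymbol\alpha^{(\ell)}=\sum_{k=1}^K\alpha^{(\ell)}_k\delta_{A_k}$, a probability measure on $(\Delta_p,d)$, and $W(\cdot,\cdot;d)$ is the order-1 Wasserstein distance with ground metric $d$. An index $j\in\{1,\dots,p\}$ is an anchor word of topic $k$ if $A_{jk}>0$ and $A_{jk'}=0$ for all $k'\ne k$; the anchor word assumption says every topic has at least one anchor word. Let $m$ be the total number of anchor words. $\Theta_A$ is the set of $A$ with columns in $\Delta_p$, $\min_j\|A_{j\cdot}\|_\infty\ge c'/p$, satisfying the anchor word assumption with $m\le c\,p$. $\Theta_\alpha(\tau)=\{\alpha\in\Delta_K:\|\alpha\|_0\le\tau\}$. For a matrix $B$ with $K$ columns and $1\le k\le K$, $\kappa(B,k)=\min_{S\subseteq\{1,\dots,K\},|S|\le k}\min_{v\in\mathcal C(S)}\|Bv\|_1/\|v\|_1$ with $\mathcal C(S)=\{v\in\mathbb{R}^K\setminus\{0\}:\|v_S\|_1\ge\|v_{S^c}\|_1\}$.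 For $\alpha\in\Delta_K$ let $\overline J(\alpha)=\{j:(A\alpha)_j>0\}$ and let $A_{\overline J}$ be the submatrix of $A$ with rows in $\overline J$. Then $\overline\kappa_\tau(A)=\min_{\alpha\in\Theta_\alpha(\tau)}\kappa(A_{\overline J(\alpha)},\|\alpha\|_0)$. *)

theory Defs
  imports
    "HOL-Probability.Probability"
    "Jordan_Normal_Form.DL_Rank"
    "Jordan_Normal_Form.DL_Submatrix"
begin

(* From here on the dollar infix is the component of a vector of explicit dimension. *)
unbundle no Finite_Cartesian_Product.vec_syntax

(* All indices start at 0: words are j < p, topics k < K, documents l < n. *)

section \<open>Simplices, norms and sparsity\<close>

definition prob_simplex :: "nat \<Rightarrow> real vec set" where
  "prob_simplex m = {x \<in> carrier_vec m. (\<forall>j<m. 0 \<le> x $ j) \<and> (\<Sum>j<m. x $ j) = 1}"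

definition norm_l0 :: "real vec \<Rightarrow> nat" where
  "norm_l0 x = card {j. j < dim_vec x \<and> x $ j \<noteq> 0}"

definition norm_l1 :: "real vec \<Rightarrow> real" where
  "norm_l1 x = (\<Sum>j<dim_vec x. \<bar>x $ j\<bar>)"

definition norm_linf :: "real vec \<Rightarrow> real" where
  "norm_linf x = Max ((\<lambda>j. \<bar>x $ j\<bar>) ` {..<dim_vec x})"

definition sparse_simplex :: "nat \<Rightarrow> nat \<Rightarrow> real vec set" where
  "sparse_simplex K \<tau> = {\<alpha> \<in> prob_simplex K. norm_l0 \<alpha> \<le> \<tau>}"


section \<open>The class of word-topic matrices\<close>

definition is_anchor :: "real mat \<Rightarrow> nat \<Rightarrow> nat \<Rightarrow> bool" where
  "is_anchor A j k \<longleftrightarrow>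
     j < dim_row A \<and> k < dim_col A \<and> A $$ (j, k) > 0 \<and>
     (\<forall>k'<dim_col A. k' \<noteq> k \<longrightarrow> A $$ (j, k') = 0)"

definition num_anchors :: "real mat \<Rightarrow> nat" where
  "num_anchors A = card {j. \<exists>k. is_anchor A j k}"

definition topic_matrices :: "real \<Rightarrow> real \<Rightarrow> nat \<Rightarrow> nat \<Rightarrow> real mat set" where
  "topic_matrices c c' p K = {A \<in> carrier_mat p K.
     (\<forall>k<K. col A k \<in> prob_simplex p) \<and>
     (\<forall>j<p. norm_linf (row A j) \<ge> c' / real p) \<and>
     (\<forall>k<K. \<exists>j<p. is_anchor A j k) \<and>
     real (num_anchors A) \<le> c * real p}"


section \<open>Restricted condition numbers\<close>

definition kappa_cone :: "nat \<Rightarrow> nat set \<Rightarrow> real vec set" where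
  "kappa_cone K S = {v \<in> carrier_vec K. v \<noteq> 0\<^sub>v K \<and>
     (\<Sum>k\<in>S. \<bar>v $ k\<bar>) \<ge> (\<Sum>k\<in>{..<K} - S. \<bar>v $ k\<bar>)}"

(* The minima are attained. The two nested ones are taken jointly over the pairs (S, v): the cone of the empty S is
   empty, so that S contributes nothing (a minimum over the empty set being infinite), whereas
   an inner infimum of the empty set of reals would be an arbitrary number. *)
definition kappa :: "real mat \<Rightarrow> nat \<Rightarrow> real" where
  "kappa B k = Inf {norm_l1 (B *\<^sub>v v) / norm_l1 v | S v.
     S \<subseteq> {..<dim_col B} \<and> card S \<le> k \<and> v \<in> kappa_cone (dim_col B) S}"

definition support_words :: "real mat \<Rightarrow> real vec \<Rightarrow> nat set" where
  "support_words A \<alpha> = {j. j < dim_row A \<and> (A *\<^sub>v \<alpha>) $ j > 0}"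

definition kappa_bar :: "nat \<Rightarrow> real mat \<Rightarrow> real" where
  "kappa_bar \<tau> A =
     (INF \<alpha>\<in>sparse_simplex (dim_col A) \<tau>.
        kappa (submatrix A (support_words A \<alpha>) UNIV) (norm_l0 \<alpha>))"


section \<open>Topic models\<close>

definition categorical :: "real vec \<Rightarrow> nat pmf" where
  "categorical r = embed_pmf (\<lambda>j. if j < dim_vec r then r $ j else 0)"

(* The vector of word counts of N independent draws from r. *)
definition multinomial :: "nat \<Rightarrow> real vec \<Rightarrow> nat vec pmf" where
  "multinomial N r =
     map_pmf (\<lambda>ws. vec (dim_vec r) (count_list ws)) (replicate_pmf N (categorical r))"

(* Column l of T is the vector of topic proportions of document l. *)
definition topic_models ::
  "real \<Rightarrow> real \<Rightarrow> nat \<Rightarrow> nat \<Rightarrow> nat \<Rightarrow> (real mat \<times> real mat) set" where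
  "topic_models c c' p K n = {(A, T). A \<in> topic_matrices c c' p K \<and>
     T \<in> carrier_mat K n \<and> (\<forall>l<n. col T l \<in> prob_simplex K) \<and> vec_space.rank K T = K}"

(* Joint law of the independent documents; coordinates l >= n are set to a dummy value. *)
definition data_law :: "nat \<Rightarrow> nat \<Rightarrow> real mat \<times> real mat \<Rightarrow> (nat \<Rightarrow> nat vec) pmf" where
  "data_law n N = (\<lambda>(A, T).
     Pi_pmf {..<n} (0\<^sub>v (dim_row A)) (\<lambda>l. multinomial N (A *\<^sub>v col T l)))"


section \<open>Measures on a metric space and the Wasserstein distance\<close>

definition borel_metric :: "'a set \<Rightarrow> ('a \<Rightarrow> 'a \<Rightarrow> real) \<Rightarrow> 'a measure" where
  "borel_metric M d = sigma M {U. openin (Metric_space.mtopology M d) U}"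

definition couplings :: "'a measure \<Rightarrow> 'a measure \<Rightarrow> ('a \<times> 'a) measure set" where
  "couplings \<mu> \<nu> = {\<pi>. sets \<pi> = sets (\<mu> \<Otimes>\<^sub>M \<nu>) \<and> distr \<pi> \<mu> fst = \<mu> \<and> distr \<pi> \<nu> snd = \<nu>}"

definition wasserstein :: "('a \<Rightarrow> 'a \<Rightarrow> real) \<Rightarrow> 'a measure \<Rightarrow> 'a measure \<Rightarrow> ennreal" where
  "wasserstein d \<mu> \<nu> = (INF \<pi>\<in>couplings \<mu> \<nu>. \<integral>\<^sup>+ z. ennreal (d (fst z) (snd z)) \<partial>\<pi>)"

definition mixing_measure ::
  "(real vec \<Rightarrow> real vec \<Rightarrow> real) \<Rightarrow> real mat \<Rightarrow> real vec \<Rightarrow> real vec measure" where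
  "mixing_measure d A \<alpha> = (let M = borel_metric (prob_simplex (dim_row A)) d in
     measure_of (space M) (sets M)
       (\<lambda>X. \<Sum>k<dim_col A. ennreal (\<alpha> $ k) * emeasure (return M (col A k)) X))"


section \<open>Estimators and risk\<close>

(* The sample space of count data is discrete. *)
definition estimators ::
  "nat \<Rightarrow> (real vec \<Rightarrow> real vec \<Rightarrow> real) \<Rightarrow> ((nat \<Rightarrow> nat vec) \<Rightarrow> real vec measure) set" where
  "estimators p d = count_space UNIV \<rightarrow>\<^sub>M prob_algebra (borel_metric (prob_simplex p) d)"

definition wasserstein_risk ::
  "(real vec \<Rightarrow> real vec \<Rightarrow> real) \<Rightarrow> nat \<Rightarrow> nat \<Rightarrow> nat \<Rightarrow>
   ((nat \<Rightarrow> nat vec) \<Rightarrow> real vec measure) \<Rightarrow> real mat \<times> real mat \<Rightarrow> ennreal" where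
  "wasserstein_risk d n N i est = (\<lambda>(A, T).
     \<integral>\<^sup>+ Y. wasserstein d (est Y) (mixing_measure d A (col T i))
       \<partial>measure_pmf (data_law n N (A, T)))"

end

theory Submission
  imports Defs
begin

text \<open>
  Both terms of the bound are forced by the limited information in document \<open>i\<close> alone. All other documents are
  given laws that carry nothing about the unknown, and the rank condition on the proportions is met by
  letting them run through the pure topics \<open>1, \<dots>, K - 1\<close>.

  For the term \<open>sqrt (\<tau> / N)\<close> the matrix is \<open>A0\<close> itself and the proportions of document \<open>i\<close> are a
  perturbation of the uniform weights on \<open>\<tau>\<close> topics: for each pair \<open>2b, 2b + 1\<close> of topics a bit decides
  which of the two gains the relative amount \<open>h\<close> and which loses it (\<open>pair_weight\<close>). The word law is a
  mixture of the topics, and the laws before and after changing one bit have chi-square divergence at most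
  \<open>16 h\<^sup>2 / \<tau>\<close>, whatever the topics are. With \<open>h\<close> of order \<open>sqrt (\<tau> / N)\<close> the \<open>N\<close> words of the document cannot
  settle a bit, and Assouad's argument gives an error of order \<open>h\<close> for the weights in the 1-norm. In Wasserstein
  distance mass that is at the wrong topic has to travel half the least distance between two
  topics, and that distance is at least \<open>cd * kappa_bar \<tau> A0\<close> because the difference of two unit vectors
  lies in one of the cones that define the condition number (\<open>weights_lower_bound\<close>).

  For the term \<open>sqrt (p * K / (n * N))\<close> document \<open>i\<close> is purely about topic 0, no other document mentions that
  topic, and its word distribution is the unknown: again a paired perturbation of a uniform law, now over
  more than \<open>p / 2\<close> words. The same argument with the trivial mixture gives an error of order
  \<open>sqrt (p / N)\<close>, capped by a constant, for the position of the single atom of the mixing measure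
  (\<open>topic_lower_bound\<close>). Since \<open>K \<le> n\<close>, this is of no smaller order than \<open>sqrt (p * K / (n * N))\<close>; the cap is harmless
  because the latter is at most 1.
\<close>

section \<open>Indistinguishable laws\<close>

text \<open>
  Two losses that can never both be small force a large total risk under the two laws. This
  says that the total variation distance is at most one half; stated through losses it passes directly to images and to products with a common law.
\<close>

definition inseparable :: "'a pmf \<Rightarrow> 'a pmf \<Rightarrow> bool" where
  "inseparable P Q \<longleftrightarrow> (\<forall>F G s. (\<forall>x. ennreal s \<le> F x + G x) \<longrightarrow>
     ennreal (s / 2) \<le> (\<integral>\<^sup>+x. F x \<partial>measure_pmf P) + (\<integral>\<^sup>+x. G x \<partial>measure_pmf Q))"

lemma inseparableD:
  "inseparable P Q \<Longrightarrow> (\<And>x. ennreal s \<le> F x + G x) \<Longrightarrow>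
     ennreal (s / 2) \<le> (\<integral>\<^sup>+x. F x \<partial>measure_pmf P) + (\<integral>\<^sup>+x. G x \<partial>measure_pmf Q)"
  by (auto simp: inseparable_def)

lemma inseparable_map_pmf:
  "inseparable P Q \<Longrightarrow> inseparable (map_pmf f P) (map_pmf f Q)"
  by (auto simp: inseparable_def)

lemma inseparable_pair_pmf:
  assumes "inseparable P Q"
  shows "inseparable (pair_pmf R P) (pair_pmf R Q)"
  unfolding inseparable_def
proof (intro allI impI)
  fix F G :: "'b \<times> 'a \<Rightarrow> ennreal" and s :: real
  assume FG: "\<forall>x. ennreal s \<le> F x + G x"
  have "ennreal (s / 2) = (\<integral>\<^sup>+y. ennreal (s / 2) \<partial>measure_pmf R)"
    by simp
  also have "\<dots> \<le> (\<integral>\<^sup>+y. (\<integral>\<^sup>+x. F (y, x) \<partial>measure_pmf P) + (\<integral>\<^sup>+x. G (y, x) \<partial>measure_pmf Q) \<partial>measure_pmf R)"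
    by (intro nn_integral_mono inseparableD[OF assms] FG[rule_format])
  also have "\<dots> = (\<integral>\<^sup>+x. F x \<partial>measure_pmf (pair_pmf R P)) + (\<integral>\<^sup>+x. G x \<partial>measure_pmf (pair_pmf R Q))"
    by (simp add: nn_integral_pair_pmf' nn_integral_add)
  finally show "ennreal (s / 2) \<le> (\<integral>\<^sup>+x. F x \<partial>measure_pmf (pair_pmf R P)) + (\<integral>\<^sup>+x. G x \<partial>measure_pmf (pair_pmf R Q))" .
qed

text \<open>
  Change of measure for independent draws: the likelihood ratio of the sample is the product of the
  ratios of the draws.
\<close>

lemma nn_integral_replicate_pmf_change:
  fixes F :: "'a list \<Rightarrow> ennreal"
  assumes pq: "\<And>x. pmf p x = \<rho> x * pmf q x" and \<rho>: "\<And>x. 0 \<le> \<rho> x"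
  shows "(\<integral>\<^sup>+xs. F xs \<partial>measure_pmf (replicate_pmf N p)) =
    (\<integral>\<^sup>+xs. ennreal (prod_list (map \<rho> xs)) * F xs \<partial>measure_pmf (replicate_pmf N q))"
proof (induction N arbitrary: F)
  case (Suc N)
  have "(\<integral>\<^sup>+x. f x \<partial>measure_pmf p) = (\<integral>\<^sup>+x. ennreal (\<rho> x) * f x \<partial>measure_pmf q)" for f
    by (simp add: nn_integral_measure_pmf pq \<rho> ennreal_mult mult_ac)
  then show ?case
    by (simp add: Suc.IH ennreal_mult' \<rho> mult.assoc nn_integral_cmult)
qed simp

lemma nn_integral_replicate_pmf_prod_list:
  assumes "\<And>x. 0 \<le> g x"
  shows "(\<integral>\<^sup>+xs. ennreal (prod_list (map g xs)) \<partial>measure_pmf (replicate_pmf N q)) =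
    (\<integral>\<^sup>+x. ennreal (g x) \<partial>measure_pmf q) ^ N"
proof (induction N)
  case (Suc N)
  then show ?case
    by (simp add: ennreal_mult' assms nn_integral_cmult nn_integral_multc)
qed simp

lemma prod_list_map_power2:
  "prod_list (map (\<lambda>x. (g x)\<^sup>2) xs) = (prod_list (map g xs) :: real)\<^sup>2"
  by (induction xs) (auto simp: power_mult_distrib)

text \<open>
  The pointwise bound \<open>min 1 r \<ge> r - r\<^sup>2 / 4\<close> turns the second moment of the likelihood ratio \<open>r\<close>
  into a lower bound on the total risk, so neither the total variation nor the Hellinger distance has
  to be computed. The second moment of a sample is the \<open>N\<close>-th power of that of one draw.
\<close>

lemma inseparable_replicate_pmf:
  fixes p q :: "'a pmf"
  assumes pq: "\<And>x. pmf p x = \<rho> x * pmf q x" and \<rho>: "\<And>x. 0 \<le> \<rho> x"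
    and moment: "(\<integral>\<^sup>+x. ennreal ((\<rho> x)\<^sup>2) \<partial>measure_pmf q) ^ N \<le> 2"
  shows "inseparable (replicate_pmf N p) (replicate_pmf N q)"
  unfolding inseparable_def
proof (intro allI impI)
  fix F G :: "'a list \<Rightarrow> ennreal" and s :: real
  assume FG: "\<forall>xs. ennreal s \<le> F xs + G xs"
  define Q where "Q = measure_pmf (replicate_pmf N q)"
  define R where "R xs = prod_list (map \<rho> xs)" for xs
  have R0: "R xs \<ge> 0" for xs
    unfolding R_def by (induction xs) (auto simp: \<rho>)
  have R1: "(\<integral>\<^sup>+xs. ennreal (R xs) \<partial>Q) = 1"
    using nn_integral_replicate_pmf_change[OF pq \<rho>, of N "\<lambda>_. 1"]
    by (simp add: Q_def R_def)
  have R2: "(\<integral>\<^sup>+xs. ennreal ((R xs)\<^sup>2) \<partial>Q) \<le> 2"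
    using moment nn_integral_replicate_pmf_prod_list[of "\<lambda>x. (\<rho> x)\<^sup>2" N q]
    by (simp add: Q_def R_def prod_list_map_power2)
  show "ennreal (s / 2) \<le> (\<integral>\<^sup>+x. F x \<partial>measure_pmf (replicate_pmf N p)) + (\<integral>\<^sup>+x. G x \<partial>measure_pmf (replicate_pmf N q))"
  proof (cases "s \<le> 0")
    case False
    then have s: "s > 0" by simp
    have point: "ennreal s * ennreal (R xs) \<le> ennreal (R xs) * F xs + G xs + ennreal (s / 4) * ennreal ((R xs)\<^sup>2)" for xs
    proof -
      \<comment> \<open>The losses weighted with \<open>R xs\<close> and 1 are worth at least \<open>s * m\<close>.\<close>
      define m where "m = min 1 (R xs)"
      have m: "0 \<le> m" "m \<le> 1" "m \<le> R xs" using R0 by (auto simp: m_def)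
      have "R xs \<le> m + (R xs)\<^sup>2 / 4"
        using sum_squares_ge_zero[of "R xs / 2 - 1" 0] R0[of xs]
        by (auto simp: m_def min_def power2_eq_square algebra_simps)
      then have "s * R xs \<le> s * m + s / 4 * (R xs)\<^sup>2"
        using s by (metis distrib_left mult_left_mono less_imp_le times_divide_eq_left times_divide_eq_right)
      then have "ennreal s * ennreal (R xs) \<le> ennreal (s * m + s / 4 * (R xs)\<^sup>2)"
        using s R0 by (simp add: ennreal_mult'[symmetric] ennreal_leI)
      also have "\<dots> = ennreal m * ennreal s + ennreal (s / 4) * ennreal ((R xs)\<^sup>2)"
        using s m by (simp add: ennreal_mult'[symmetric] ennreal_plus[symmetric] mult.commute del: ennreal_plus)
      also have "ennreal m * ennreal s \<le> ennreal m * (F xs + G xs)"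
        by (intro mult_left_mono FG[rule_format]) simp
      also have "\<dots> \<le> ennreal (R xs) * F xs + 1 * G xs"
        unfolding distrib_left using m
        by (intro add_mono mult_right_mono ennreal_leI) (auto simp: ennreal_le_1)
      finally show ?thesis by (simp add: add_mono)
    qed
    have "ennreal s = (\<integral>\<^sup>+xs. ennreal s * ennreal (R xs) \<partial>Q)"
      unfolding Q_def by (subst nn_integral_cmult) (simp_all add: R1[unfolded Q_def])
    also have "\<dots> \<le> (\<integral>\<^sup>+xs. ennreal (R xs) * F xs + G xs + ennreal (s / 4) * ennreal ((R xs)\<^sup>2) \<partial>Q)"
      by (intro nn_integral_mono point)
    also have "\<dots> = (\<integral>\<^sup>+xs. ennreal (R xs) * F xs \<partial>Q) + (\<integral>\<^sup>+xs. G xs \<partial>Q) + ennreal (s / 4) * (\<integral>\<^sup>+xs. ennreal ((R xs)\<^sup>2) \<partial>Q)"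
      unfolding Q_def by (simp add: nn_integral_add nn_integral_cmult)
    also have "\<dots> \<le> (\<integral>\<^sup>+xs. ennreal (R xs) * F xs \<partial>Q) + (\<integral>\<^sup>+xs. G xs \<partial>Q) + ennreal (s / 4) * 2"
      by (intro add_left_mono mult_left_mono R2) simp
    also have "ennreal (s / 4) * 2 = ennreal (s / 2)"
      using s ennreal_mult'[of "s / 4" 2] by simp
    finally have "ennreal (s / 2) + ennreal (s / 2) \<le> (\<integral>\<^sup>+xs. ennreal (R xs) * F xs \<partial>Q) + (\<integral>\<^sup>+xs. G xs \<partial>Q) + ennreal (s / 2)"
      using s by (simp flip: ennreal_plus)
    then have "ennreal (s / 2) \<le> (\<integral>\<^sup>+xs. ennreal (R xs) * F xs \<partial>Q) + (\<integral>\<^sup>+xs. G xs \<partial>Q)"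
      using ennreal_add_left_cancel_le[of "ennreal (s / 2)"] by (simp add: add.commute)
    then show ?thesis
      by (simp add: nn_integral_replicate_pmf_change[OF pq \<rho>, of N F] Q_def R_def)
  qed (simp add: ennreal_neg)
qed

text \<open>
  Assouad's lemma. The laws are indexed by the set of bits that are on. For a fixed bit \<open>b\<close> they fall into
  pairs \<open>S\<close>, \<open>insert b S\<close>, and on each pair no procedure avoids the risk of one of the two losses for that bit;
  the risks of different bits add up.
\<close>

lemma assouad:
  fixes P :: "nat set \<Rightarrow> 'a pmf" and loss :: "nat \<Rightarrow> bool \<Rightarrow> 'a \<Rightarrow> ennreal"
  assumes insep: "\<And>S b. S \<subseteq> {..<M} \<Longrightarrow> b < M \<Longrightarrow> b \<notin> S \<Longrightarrow> inseparable (P S) (P (insert b S))"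
    and separated: "\<And>b x. b < M \<Longrightarrow> ennreal s \<le> loss b False x + loss b True x"
    and s: "0 \<le> s"
  shows "2 ^ M * ennreal (real M * s / 4) \<le>
    (\<Sum>S\<in>Pow {..<M}. \<integral>\<^sup>+x. (\<Sum>b<M. loss b (b \<in> S) x) \<partial>measure_pmf (P S))"
proof -
  have bit: "2 ^ M * ennreal (s / 4) \<le> (\<Sum>S\<in>Pow {..<M}. \<integral>\<^sup>+x. loss b (b \<in> S) x \<partial>measure_pmf (P S))"
    if b: "b < M" for b
  proof -
    define B where "B = {..<M} - {b}"
    have M: "{..<M} = insert b B" "b \<notin> B" "finite B" "card B = M - 1"
      using b by (auto simp: B_def)
    have nb: "b \<notin> S" if "S \<in> Pow B" for S using that M by auto
    have disj: "Pow B \<inter> insert b ` Pow B = {}" using M by auto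
    have inj: "inj_on (insert b) (Pow B)" using M by (auto simp: inj_on_def)
    have two: "(2::ennreal) ^ M = 2 ^ (M - 1) * 2" using b by (cases M) (auto simp: mult.commute)
    have "2 ^ M * ennreal (s / 4) = (\<Sum>S\<in>Pow B. ennreal (s / 2))"
      using M ennreal_mult'[of 2 "s / 4"] s by (simp add: card_Pow two mult.assoc)
    also have "\<dots> \<le> (\<Sum>S\<in>Pow B. (\<integral>\<^sup>+x. loss b False x \<partial>measure_pmf (P S)) + (\<integral>\<^sup>+x. loss b True x \<partial>measure_pmf (P (insert b S))))"
      by (intro sum_mono inseparableD[OF insep] separated b) (auto simp: B_def)
    also have "\<dots> = (\<Sum>S\<in>Pow B. \<integral>\<^sup>+x. loss b (b \<in> S) x \<partial>measure_pmf (P S)) + (\<Sum>S\<in>insert b ` Pow B. \<integral>\<^sup>+x. loss b (b \<in> S) x \<partial>measure_pmf (P S))"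
      unfolding sum.distrib sum.reindex[OF inj] using nb
      by (intro arg_cong2[of _ _ _ _ "(+)"] sum.cong) (simp_all add: o_def)
    also have "\<dots> = (\<Sum>S\<in>Pow {..<M}. \<integral>\<^sup>+x. loss b (b \<in> S) x \<partial>measure_pmf (P S))"
      unfolding M(1) Pow_insert by (rule sum.union_disjoint[symmetric]) (use M disj in auto)
    finally show ?thesis .
  qed
  have "2 ^ M * ennreal (real M * s / 4) = (\<Sum>b<M. 2 ^ M * ennreal (s / 4))"
    using ennreal_mult'[of "real M" "s / 4"] by (simp add: ennreal_of_nat_eq_real_of_nat mult_ac)
  also have "\<dots> \<le> (\<Sum>b<M. \<Sum>S\<in>Pow {..<M}. \<integral>\<^sup>+x. loss b (b \<in> S) x \<partial>measure_pmf (P S))"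
    by (intro sum_mono bit) auto
  also have "\<dots> = (\<Sum>S\<in>Pow {..<M}. \<integral>\<^sup>+x. (\<Sum>b<M. loss b (b \<in> S) x) \<partial>measure_pmf (P S))"
    by (subst sum.swap) (simp add: nn_integral_sum)
  finally show ?thesis .
qed

section \<open>Multinomial documents\<close>

lemma pmf_categorical:
  assumes "r \<in> prob_simplex m"
  shows "pmf (categorical r) j = (if j < m then r $ j else 0)"
proof -
  have r: "dim_vec r = m" "\<And>j. j < m \<Longrightarrow> 0 \<le> r $ j" "(\<Sum>j<m. r $ j) = 1"
    using assms by (auto simp: prob_simplex_def)
  have "(\<integral>\<^sup>+j. ennreal (if j < m then r $ j else 0) \<partial>count_space UNIV) =
    (\<integral>\<^sup>+j. ennreal (if j < m then r $ j else 0) * indicator {..<m} j \<partial>count_space UNIV)"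
    by (intro nn_integral_cong) (auto simp: indicator_def)
  also have "\<dots> = (\<Sum>j<m. ennreal (r $ j))"
    by (simp add: nn_integral_count_space_indicator[symmetric] nn_integral_count_space_finite)
  also have "\<dots> = 1"
    using r by (subst sum_ennreal) auto
  finally show ?thesis
    unfolding categorical_def r(1) by (subst pmf_embed_pmf) (use r in auto)
qed

text \<open>
  The sum in the last hypothesis is one plus the chi-square divergence of the word laws. A divergence of
  \<open>1 / (2 * N)\<close> per word leaves a second moment of at most \<open>exp (1 / 2) \<le> 2\<close> for the whole document.
\<close>

lemma inseparable_multinomial:
  assumes r: "r \<in> prob_simplex m" and r': "r' \<in> prob_simplex m" and N: "N > 0"
    and ac: "\<And>j. j < m \<Longrightarrow> r' $ j = 0 \<Longrightarrow> r $ j = 0"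
    and chi: "(\<Sum>j<m. (r $ j)\<^sup>2 / r' $ j) \<le> 1 + 1 / (2 * real N)"
  shows "inseparable (multinomial N r) (multinomial N r')"
proof -
  have dim: "dim_vec r = m" "dim_vec r' = m" using r r' by (auto simp: prob_simplex_def)
  have nonneg: "0 \<le> r $ j" "0 \<le> r' $ j" if "j < m" for j
    using that r r' by (auto simp: prob_simplex_def)
  define \<rho> where "\<rho> j = (if j < m then r $ j / r' $ j else 0)" for j
  define q where "q = categorical r'"
  have "(\<integral>\<^sup>+j. ennreal ((\<rho> j)\<^sup>2) \<partial>measure_pmf q) = (\<Sum>j<m. ennreal ((\<rho> j)\<^sup>2) * ennreal (pmf q j))"
    by (rule nn_integral_measure_pmf_support) (auto simp: \<rho>_def)
  also have "\<dots> = (\<Sum>j<m. ennreal ((r $ j)\<^sup>2 / r' $ j))"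
  proof (intro sum.cong refl)
    fix j assume "j \<in> {..<m}"
    then show "ennreal ((\<rho> j)\<^sup>2) * ennreal (pmf q j) = ennreal ((r $ j)\<^sup>2 / r' $ j)"
      using nonneg by (subst ennreal_mult'[symmetric])
        (auto simp: q_def pmf_categorical[OF r'] \<rho>_def power2_eq_square)
  qed
  also have "\<dots> = ennreal (\<Sum>j<m. (r $ j)\<^sup>2 / r' $ j)"
    using nonneg by (intro sum_ennreal) auto
  also have "\<dots> \<le> ennreal (1 + 1 / (2 * real N))"
    by (intro ennreal_leI chi)
  finally have "(\<integral>\<^sup>+j. ennreal ((\<rho> j)\<^sup>2) \<partial>measure_pmf q) ^ N \<le> ennreal (1 + 1 / (2 * real N)) ^ N"
    by (rule power_mono) simp
  also have "\<dots> = ennreal ((1 + 1 / (2 * real N)) ^ N)"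
    by (rule ennreal_power) simp
  also have "\<dots> \<le> ennreal 2"
  proof (rule ennreal_leI)
    have "(1 + 1 / (2 * real N)) ^ N \<le> exp (1 / (2 * real N)) ^ N"
      by (intro power_mono exp_ge_add_one_self) simp
    also have "\<dots> = exp (1 / 2)"
      using N by (simp flip: exp_of_nat_mult)
    also have "\<dots> \<le> 2"
      using exp_bound[of "1 / 2"] by (simp add: power2_eq_square)
    finally show "(1 + 1 / (2 * real N)) ^ N \<le> 2" .
  qed
  finally have moment: "(\<integral>\<^sup>+j. ennreal ((\<rho> j)\<^sup>2) \<partial>measure_pmf q) ^ N \<le> 2" by simp
  have "inseparable (replicate_pmf N (categorical r)) (replicate_pmf N q)"
    using ac nonneg
    by (intro inseparable_replicate_pmf[where \<rho> = \<rho>] moment)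
      (auto simp: \<rho>_def q_def pmf_categorical[OF r] pmf_categorical[OF r'])
  then show ?thesis
    unfolding multinomial_def dim q_def by (rule inseparable_map_pmf)
qed

text \<open>
  Separating document \<open>i\<close> from the others exhibits the data as an image of an independent pair, of which
  only one component will depend on the unknown parameter.
\<close>

lemma data_law_document:
  assumes i: "i < n"
  shows "data_law n N (A, T) =
    map_pmf (\<lambda>(Y, y). Y(i := y))
      (pair_pmf (Pi_pmf ({..<n} - {i}) (0\<^sub>v (dim_row A)) (\<lambda>l. multinomial N (A *\<^sub>v col T l)))
        (multinomial N (A *\<^sub>v col T i)))"
proof -
  have n: "{..<n} = insert i ({..<n} - {i})" using i by auto
  show ?thesis
    unfolding data_law_def prod.case
    apply (subst n)
    apply (subst Pi_pmf_insert)
      apply simp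
     apply simp
    apply (subst pair_commute_pmf)
    apply (simp add: pmf.map_comp o_def case_prod_beta')
    done
qed

lemma inseparable_data_law:
  assumes i: "i < n" and dim: "dim_row A = dim_row A'"
    and others: "\<And>l. l < n \<Longrightarrow> l \<noteq> i \<Longrightarrow> A *\<^sub>v col T l = A' *\<^sub>v col T' l"
    and document: "inseparable (multinomial N (A *\<^sub>v col T i)) (multinomial N (A' *\<^sub>v col T' i))"
  shows "inseparable (data_law n N (A, T)) (data_law n N (A', T'))"
proof -
  have "Pi_pmf ({..<n} - {i}) (0\<^sub>v (dim_row A)) (\<lambda>l. multinomial N (A *\<^sub>v col T l)) =
    Pi_pmf ({..<n} - {i}) (0\<^sub>v (dim_row A')) (\<lambda>l. multinomial N (A' *\<^sub>v col T' l))"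
    unfolding dim by (intro Pi_pmf_cong) (auto simp: others)
  then show ?thesis
    unfolding data_law_document[OF i]
    by (simp only:) (intro inseparable_map_pmf inseparable_pair_pmf document)
qed

section \<open>Paired perturbations of uniform weights\<close>

text \<open>
  The two members of a pair get opposite signs, so that the perturbed weights still sum to one; the
  bit of pair \<open>b\<close> is on when \<open>b \<in> S\<close>.
\<close>

definition pair_sign :: "nat set \<Rightarrow> nat \<Rightarrow> real" where
  "pair_sign S k = (if (k div 2 \<in> S) = even k then 1 else - 1)"

text \<open>
  For odd \<open>L\<close> the last index has no partner and keeps the weight \<open>1 / L\<close>.
\<close>

definition pair_weight :: "nat \<Rightarrow> real \<Rightarrow> nat set \<Rightarrow> nat \<Rightarrow> real" where
  "pair_weight L h S k = (if k div 2 < L div 2 then 1 + h * pair_sign S k else 1) / real L"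

lemma pair_weight_bounds:
  assumes "0 \<le> h" "h \<le> 1 / 2" "L > 0"
  shows "1 / (2 * real L) \<le> pair_weight L h S k"
  using assms by (auto simp: pair_weight_def pair_sign_def field_simps)

lemma sum_pair_weight:
  assumes L: "L > 0"
  shows "(\<Sum>k<L. pair_weight L h S k) = 1"
proof -
  have zero: "(\<Sum>k<2 * M. pair_sign S k) = 0" for M
    by (induction M) (auto simp: pair_sign_def)
  have "(\<Sum>k<L. if k div 2 < L div 2 then pair_sign S k else 0) = (\<Sum>k<2 * (L div 2). pair_sign S k)"
    by (rule sum.mono_neutral_cong_right) auto
  then have "(\<Sum>k<L. 1 + h * (if k div 2 < L div 2 then pair_sign S k else 0)) = real L"
    unfolding sum.distrib sum_distrib_left[symmetric] zero by simp
  moreover have "(\<Sum>k<L. pair_weight L h S k) =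
    (\<Sum>k<L. 1 + h * (if k div 2 < L div 2 then pair_sign S k else 0)) / real L"
    unfolding sum_divide_distrib by (intro sum.cong) (auto simp: pair_weight_def)
  ultimately show ?thesis using L by simp
qed

lemma pair_weight_separated:
  assumes "0 \<le> h" "b < L div 2" "L > 0"
  shows "2 * h / real L \<le> \<bar>x - pair_weight L h {} (2 * b)\<bar> + \<bar>x - pair_weight L h {b} (2 * b)\<bar>"
proof -
  have "pair_weight L h {b} (2 * b) - pair_weight L h {} (2 * b) = 2 * h / real L"
    using assms by (auto simp: pair_weight_def pair_sign_def field_simps)
  then show ?thesis by linarith
qed

lemma pair_weight_even:
  "pair_weight L h S (2 * b) = pair_weight L h (if b \<in> S then {b} else {}) (2 * b)"
  by (auto simp: pair_weight_def pair_sign_def)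

text \<open>
  Written so that the linear terms sum to the total masses: the chi-square sum of two laws then needs a
  bound only on the total of \<open>a\<close>.
\<close>

lemma chi_square_step:
  fixes x y a c :: real
  assumes "0 \<le> y" "0 \<le> a" "a \<le> c * y" "\<bar>x - y\<bar> \<le> \<eta> * a"
  shows "x\<^sup>2 / y \<le> 2 * x - y + c * \<eta>\<^sup>2 * a"
proof (cases "y = 0")
  case True
  then show ?thesis using assms by auto
next
  case False
  then have y: "y > 0" using assms by simp
  have "(x - y)\<^sup>2 \<le> (\<eta> * a)\<^sup>2"
    using assms(4) by (metis abs_ge_zero power2_abs power_mono)
  also have "\<dots> = \<eta>\<^sup>2 * a * a" by (simp add: power2_eq_square)
  also have "\<dots> \<le> \<eta>\<^sup>2 * a * (c * y)"
    using assms by (intro mult_left_mono) auto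
  finally have "(x - y)\<^sup>2 / y \<le> c * \<eta>\<^sup>2 * a"
    using y by (simp add: divide_le_eq mult_ac)
  moreover have "x\<^sup>2 / y = 2 * x - y + (x - y)\<^sup>2 / y"
    using y by (simp add: field_simps power2_eq_square)
  ultimately show ?thesis by linarith
qed

text \<open>
  Flipping bit \<open>b\<close> moves the mass \<open>2 * h / L\<close> between the components \<open>Q (2 * b)\<close> and \<open>Q (2 * b + 1)\<close>. The
  same two components also enter the mixture itself with weight at least \<open>1 / (2 * L)\<close>, so they dominate
  the change word by word, and the divergence is of order \<open>h\<^sup>2 / L\<close> for arbitrary components.
\<close>

lemma inseparable_mixtures:
  fixes Q :: "nat \<Rightarrow> real vec" and h :: real and L m :: nat
  defines "r \<equiv> \<lambda>S. vec m (\<lambda>j. \<Sum>k<L. pair_weight L h S k * Q k $ j)"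
  assumes Q: "\<And>k. k < L \<Longrightarrow> Q k \<in> prob_simplex m"
    and h: "0 \<le> h" "h \<le> 1 / 2" "h\<^sup>2 \<le> real L / (32 * real N)" and N: "N > 0"
    and b: "b < L div 2" "b \<notin> S"
  shows "inseparable (multinomial N (r S)) (multinomial N (r (insert b S)))"
proof -
  have L: "L > 0" using b by auto
  have Q0: "0 \<le> Q k $ j" if "k < L" "j < m" for k j
    using Q[OF that(1)] that(2) by (auto simp: prob_simplex_def)
  have Q1: "(\<Sum>j<m. Q k $ j) = 1" if "k < L" for k
    using Q[OF that] by (auto simp: prob_simplex_def)
  have w0: "0 \<le> pair_weight L h S k" for S k
    using pair_weight_bounds[OF h(1,2) L] by (rule order_trans[rotated]) simp
  have simplex: "r S \<in> prob_simplex m" for S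
  proof -
    have "(\<Sum>j<m. \<Sum>k<L. pair_weight L h S k * Q k $ j) = 1"
      by (subst sum.swap) (simp add: Q1 sum_pair_weight L flip: sum_distrib_left)
    then show ?thesis
      by (auto simp: r_def prob_simplex_def intro!: sum_nonneg mult_nonneg_nonneg w0 Q0)
  qed
  define k1 k2 where "k1 = 2 * b" and "k2 = 2 * b + 1"
  have k: "k1 < L" "k2 < L" "k1 \<noteq> k2" using b by (auto simp: k1_def k2_def)
  define a where "a j = Q k1 $ j + Q k2 $ j" for j
  define \<eta> where "\<eta> = 2 * h / real L"
  have split: "(\<Sum>k<L. f k) = (\<Sum>k\<in>{..<L} - {k1, k2}. f k) + (f k1 + f k2)" for f :: "nat \<Rightarrow> real"
  proof -
    have "{..<L} = ({..<L} - {k1, k2}) \<union> {k1, k2}" using k by auto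
    then have "sum f {..<L} = sum f (({..<L} - {k1, k2}) \<union> {k1, k2})" by simp
    also have "\<dots> = sum f ({..<L} - {k1, k2}) + sum f {k1, k2}"
      by (rule sum.union_disjoint) auto
    finally show ?thesis using k(3) by simp
  qed
  have same: "pair_weight L h (insert b S) k = pair_weight L h S k" if "k \<notin> {k1, k2}" for k
  proof -
    have "k div 2 \<noteq> b" using that by (auto simp: k1_def k2_def)
    then show ?thesis by (simp add: pair_weight_def pair_sign_def)
  qed
  have diff: "pair_weight L h S k1 - pair_weight L h (insert b S) k1 = - \<eta>"
    "pair_weight L h S k2 - pair_weight L h (insert b S) k2 = \<eta>"
    using b L by (auto simp: pair_weight_def pair_sign_def k1_def k2_def \<eta>_def field_simps)
  have gap: "\<bar>r S $ j - r (insert b S) $ j\<bar> \<le> \<eta> * a j" if j: "j < m" for j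
  proof -
    have "r S $ j - r (insert b S) $ j =
      (\<Sum>k<L. (pair_weight L h S k - pair_weight L h (insert b S) k) * Q k $ j)"
      using j by (simp add: r_def sum_subtractf left_diff_distrib)
    also have "\<dots> = - \<eta> * Q k1 $ j + \<eta> * Q k2 $ j"
      unfolding split by (simp add: same diff)
    finally show ?thesis
      using Q0[OF k(1) j] Q0[OF k(2) j] h(1) L
      by (auto simp: a_def abs_le_iff distrib_left \<eta>_def)
  qed
  have large: "a j \<le> 2 * real L * r (insert b S) $ j" if j: "j < m" for j
  proof -
    have "1 / (2 * real L) * a j = 1 / (2 * real L) * Q k1 $ j + 1 / (2 * real L) * Q k2 $ j"
      by (simp add: a_def distrib_left)
    also have "\<dots> \<le> pair_weight L h (insert b S) k1 * Q k1 $ j + pair_weight L h (insert b S) k2 * Q k2 $ j"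
      by (intro add_mono mult_right_mono pair_weight_bounds h L Q0 k j)
    also have "\<dots> \<le> r (insert b S) $ j"
      unfolding r_def using j by (simp add: split) (intro sum_nonneg mult_nonneg_nonneg w0 Q0, auto)
    finally show ?thesis using L by (simp add: field_simps)
  qed
  have a0: "0 \<le> a j" if "j < m" for j using Q0 k that by (auto simp: a_def)
  have r0: "0 \<le> r S $ j" if "j < m" for j S using simplex[of S] that by (auto simp: prob_simplex_def)
  have r1: "(\<Sum>j<m. r S $ j) = 1" for S using simplex[of S] by (auto simp: prob_simplex_def)
  show ?thesis
  proof (rule inseparable_multinomial[OF simplex simplex N])
    fix j assume "j < m" "r (insert b S) $ j = 0"
    then show "r S $ j = 0" using large[of j] gap[of j] a0[of j] by auto
  next
    have "(\<Sum>j<m. (r S $ j)\<^sup>2 / r (insert b S) $ j) \<le>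
      (\<Sum>j<m. 2 * r S $ j - r (insert b S) $ j + 2 * real L * \<eta>\<^sup>2 * a j)"
      by (intro sum_mono chi_square_step r0 a0 large gap) auto
    also have "\<dots> = 2 * 1 - 1 + 2 * real L * \<eta>\<^sup>2 * 2"
      unfolding sum.distrib sum_subtractf sum_distrib_left[symmetric] r1 a_def Q1[OF k(1)] Q1[OF k(2)] by simp
    also have "\<dots> = 1 + 16 * h\<^sup>2 / real L"
      using L by (simp add: \<eta>_def power2_eq_square field_simps)
    also have "\<dots> \<le> 1 + 1 / (2 * real N)"
      using h(3) L N by (simp add: field_simps)
    finally show "(\<Sum>j<m. (r S $ j)\<^sup>2 / r (insert b S) $ j) \<le> 1 + 1 / (2 * real N)" .
  qed
qed

text \<open>
  Assouad's lemma for a family of topic models in which only the law of document \<open>i\<close> varies. The average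
  risk over the family bounds the supremum from below. There are at least \<open>L / 3\<close> pairs, the worst case being
  \<open>L = 3\<close>.
\<close>

lemma sup_risk_lower_bound:
  fixes Q :: "nat \<Rightarrow> real vec" and h :: real and L m :: nat
    and A T :: "nat set \<Rightarrow> real mat" and loss :: "nat \<Rightarrow> bool \<Rightarrow> (nat \<Rightarrow> nat vec) \<Rightarrow> ennreal"
  assumes models: "\<And>S. S \<subseteq> {..<L div 2} \<Longrightarrow> (A S, T S) \<in> \<Theta>"
    and dim: "\<And>S. S \<subseteq> {..<L div 2} \<Longrightarrow> dim_row (A S) = p"
    and i: "i < n" and N: "N > 0" and L: "L \<ge> 2"
    and h: "0 \<le> h" "h \<le> 1 / 2" "h\<^sup>2 \<le> real L / (32 * real N)"
    and others: "\<And>S S' l. S \<subseteq> {..<L div 2} \<Longrightarrow> S' \<subseteq> {..<L div 2} \<Longrightarrow> l < n \<Longrightarrow> l \<noteq> i \<Longrightarrow>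
       A S *\<^sub>v col (T S) l = A S' *\<^sub>v col (T S') l"
    and Q: "\<And>k. k < L \<Longrightarrow> Q k \<in> prob_simplex p"
    and document: "\<And>S. S \<subseteq> {..<L div 2} \<Longrightarrow>
       A S *\<^sub>v col (T S) i = vec p (\<lambda>j. \<Sum>k<L. pair_weight L h S k * Q k $ j)"
    and separated: "\<And>b Y. b < L div 2 \<Longrightarrow> ennreal (c * (2 * h / real L)) \<le> loss b False Y + loss b True Y"
    and c: "0 \<le> c"
    and risk: "\<And>S Y. S \<subseteq> {..<L div 2} \<Longrightarrow> (\<Sum>b<L div 2. loss b (b \<in> S) Y) \<le>
       wasserstein d (est Y) (mixing_measure d (A S) (col (T S) i))"
  shows "ennreal (c * h / 6) \<le> (SUP \<theta>\<in>\<Theta>. wasserstein_risk d n N i est \<theta>)"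
proof -
  define M where "M = L div 2"
  define s where "s = c * (2 * h / real L)"
  have "inseparable (data_law n N (A S, T S)) (data_law n N (A (insert b S), T (insert b S)))"
    if "S \<subseteq> {..<M}" "b < M" "b \<notin> S" for S b
  proof -
    have S: "S \<subseteq> {..<L div 2}" "insert b S \<subseteq> {..<L div 2}" using that by (auto simp: M_def)
    show ?thesis
      using that S
      by (intro inseparable_data_law[OF i] others)
        (auto simp: dim document M_def intro!: inseparable_mixtures Q h N)
  qed
  then have "2 ^ M * ennreal (real M * s / 4) \<le>
    (\<Sum>S\<in>Pow {..<M}. \<integral>\<^sup>+Y. (\<Sum>b<M. loss b (b \<in> S) Y) \<partial>measure_pmf (data_law n N (A S, T S)))"
    by (rule assouad) (use separated c h in \<open>auto simp: M_def s_def\<close>)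
  also have "\<dots> \<le> (\<Sum>S\<in>Pow {..<M}. wasserstein_risk d n N i est (A S, T S))"
    unfolding wasserstein_risk_def prod.case
    by (intro sum_mono nn_integral_mono) (use risk in \<open>auto simp: M_def\<close>)
  also have "\<dots> \<le> of_nat (card (Pow {..<M})) * (SUP \<theta>\<in>\<Theta>. wasserstein_risk d n N i est \<theta>)"
    by (intro sum_bounded_above SUP_upper models) (auto simp: M_def)
  finally have "2 ^ M * ennreal (real M * s / 4) \<le> 2 ^ M * (SUP \<theta>\<in>\<Theta>. wasserstein_risk d n N i est \<theta>)"
    by (simp add: card_Pow)
  then have "ennreal (real M * s / 4) \<le> (SUP \<theta>\<in>\<Theta>. wasserstein_risk d n N i est \<theta>)"
    by (subst (asm) ennreal_mult_le_mult_iff) (auto simp: power_eq_top_ennreal_iff)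
  moreover have "c * h / 6 \<le> real M * s / 4"
  proof -
    have "L \<le> 3 * M" using L unfolding M_def by presburger
    then have "real L \<le> 3 * real M" by linarith
    then have "c * h * real L \<le> c * h * (3 * real M)" using c h by (intro mult_left_mono) auto
    then show ?thesis using L by (simp add: s_def field_simps)
  qed
  ultimately show ?thesis by (meson ennreal_leI order_trans)
qed

section \<open>Lower bounds for the Wasserstein distance\<close>

context Metric_space
begin

lemma space_borel_metric [simp]: "space (borel_metric M d) = M"
  by (simp add: borel_metric_def space_measure_of_conv)

lemma openin_sets_borel_metric:
  assumes "openin mtopology U"
  shows "U \<in> sets (borel_metric M d)"
proof -
  have "{U. openin mtopology U} \<subseteq> Pow M"
    using openin_subset by fastforce
  then show ?thesis
    using assms by (simp add: borel_metric_def)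
qed

lemma singleton_sets_borel_metric:
  assumes "x \<in> M"
  shows "{x} \<in> sets (borel_metric M d)"
proof -
  have "openin mtopology (M - {x})"
    unfolding openin_mtopology
  proof (intro conjI allI impI)
    fix y assume y: "y \<in> M - {x}"
    then have "d y x > 0" using assms by (simp add: mdist_pos_less)
    moreover have "mball y (d y x) \<subseteq> M - {x}" by auto
    ultimately show "\<exists>r>0. mball y r \<subseteq> M - {x}" by blast
  qed auto
  then have "space (borel_metric M d) - (M - {x}) \<in> sets (borel_metric M d)"
    by (intro sets.compl_sets openin_sets_borel_metric)
  moreover have "M - (M - {x}) = {x}" using assms by auto
  ultimately show ?thesis by simp
qed

lemma lipschitz_borel_measurable:
  fixes f :: "'a \<Rightarrow> real"
  assumes "C > 0" and lip: "\<And>x y. x \<in> M \<Longrightarrow> y \<in> M \<Longrightarrow> \<bar>f x - f y\<bar> \<le> C * d x y"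
  shows "f \<in> borel_measurable (borel_metric M d)"
proof (rule borel_measurableI)
  fix U :: "real set" assume U: "open U"
  have "openin mtopology (f -` U \<inter> M)"
    unfolding openin_mtopology
  proof (intro conjI allI impI)
    fix x assume x: "x \<in> f -` U \<inter> M"
    then obtain e where e: "e > 0" "\<And>t. dist t (f x) < e \<Longrightarrow> t \<in> U"
      using U unfolding open_dist by blast
    have "mball x (e / C) \<subseteq> f -` U \<inter> M"
    proof
      fix y assume y: "y \<in> mball x (e / C)"
      then have "\<bar>f y - f x\<bar> \<le> C * d x y" using lip[of y x] x by (simp add: commute)
      also have "\<dots> < e" using y assms(1) by (simp add: less_divide_eq mult.commute)
      finally show "y \<in> f -` U \<inter> M" using y e by (simp add: dist_real_def)
    qed
    then show "\<exists>r>0. mball x r \<subseteq> f -` U \<inter> M" using e(1) assms(1) by (meson divide_pos_pos)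
  qed auto
  then show "f -` U \<inter> space (borel_metric M d) \<in> sets (borel_metric M d)"
    by (simp add: openin_sets_borel_metric)
qed

end

lemma sets_mixing_measure [simp]:
  "sets (mixing_measure d A \<alpha>) = sets (borel_metric (prob_simplex (dim_row A)) d)"
  by (simp add: mixing_measure_def Let_def)

lemma emeasure_mixing_measure:
  assumes d: "Metric_space (prob_simplex (dim_row A)) d"
    and X: "X \<in> sets (borel_metric (prob_simplex (dim_row A)) d)"
  shows "emeasure (mixing_measure d A \<alpha>) X =
    (\<Sum>k<dim_col A. ennreal (\<alpha> $ k) * indicator X (col A k))"
proof -
  interpret Metric_space "prob_simplex (dim_row A)" d by (rule d)
  define B where "B = borel_metric (prob_simplex (dim_row A)) d"
  define \<mu> where "\<mu> X = (\<Sum>k<dim_col A. ennreal (\<alpha> $ k) * emeasure (return B (col A k)) X)" for X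
  have "emeasure (measure_of (space B) (sets B) \<mu>) X = \<mu> X"
  proof (rule emeasure_measure_of_sigma)
    show "sigma_algebra (space B) (sets B)" ..
    show "positive (sets B) \<mu>" by (simp add: positive_def \<mu>_def)
    show "countably_additive (sets B) \<mu>"
    proof (rule countably_additiveI)
      fix F :: "nat \<Rightarrow> _" assume F: "range F \<subseteq> sets B" "disjoint_family F"
      have "(\<Sum>i. \<mu> (F i)) = (\<Sum>k<dim_col A. \<Sum>i. ennreal (\<alpha> $ k) * emeasure (return B (col A k)) (F i))"
        unfolding \<mu>_def by (rule suminf_sum) simp
      also have "\<dots> = \<mu> (\<Union>i. F i)"
        unfolding \<mu>_def using F
          by (simp add: ennreal_suminf_cmult suminf_emeasure del: emeasure_return)
      finally show "(\<Sum>i. \<mu> (F i)) = \<mu> (\<Union>i. F i)" .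
    qed
    show "X \<in> sets B" using X by (simp add: B_def)
  qed
  moreover have "mixing_measure d A \<alpha> = measure_of (space B) (sets B) \<mu>"
    unfolding mixing_measure_def Let_def B_def[symmetric] \<mu>_def[abs_def] ..
  ultimately show ?thesis
    using X by (simp only: \<mu>_def B_def emeasure_return)
qed

lemma coupling_marginals:
  assumes \<pi>: "\<pi> \<in> couplings \<mu> \<nu>"
  shows "fst \<in> measurable \<pi> \<mu>" "snd \<in> measurable \<pi> \<nu>" "distr \<pi> \<mu> fst = \<mu>" "distr \<pi> \<nu> snd = \<nu>"
    "space \<pi> = space \<mu> \<times> space \<nu>"
proof -
  have s: "sets \<pi> = sets (\<mu> \<Otimes>\<^sub>M \<nu>)" and "distr \<pi> \<mu> fst = \<mu>" "distr \<pi> \<nu> snd = \<nu>"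
    using \<pi> by (auto simp: couplings_def)
  then show "distr \<pi> \<mu> fst = \<mu>" "distr \<pi> \<nu> snd = \<nu>" by auto
  show "fst \<in> measurable \<pi> \<mu>" "snd \<in> measurable \<pi> \<nu>"
    using measurable_cong_sets[OF s refl] by auto
  show "space \<pi> = space \<mu> \<times> space \<nu>"
    using sets_eq_imp_space_eq[OF s] by (simp add: space_pair_measure)
qed

text \<open>
  When the second measure is concentrated at \<open>a\<close>, every coupling is carried by the pairs \<open>(x, a)\<close>, so the
  cost is an integral over the first measure.
\<close>

lemma wasserstein_dirac_ge:
  assumes f: "f \<in> borel_measurable \<mu>" and a: "{a} \<in> sets \<nu>" "emeasure \<nu> (space \<nu> - {a}) = 0"
    and le: "\<And>x. x \<in> space \<mu> \<Longrightarrow> f x \<le> ennreal (d x a)"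
  shows "(\<integral>\<^sup>+x. f x \<partial>\<mu>) \<le> wasserstein d \<mu> \<nu>"
  unfolding wasserstein_def
proof (rule INF_greatest)
  fix \<pi> assume \<pi>: "\<pi> \<in> couplings \<mu> \<nu>"
  note marg = coupling_marginals[OF \<pi>]
  have "AE y in \<nu>. y = a"
    by (rule AE_I[of _ _ "space \<nu> - {a}"]) (use a in auto)
  then have "AE y in distr \<pi> \<nu> snd. y = a" unfolding marg .
  then have AE: "AE z in \<pi>. snd z = a"
    by (rule AE_distrD[OF marg(2)])
  have "(\<integral>\<^sup>+x. f x \<partial>\<mu>) = (\<integral>\<^sup>+x. f x \<partial>distr \<pi> \<mu> fst)" unfolding marg ..
  also have "\<dots> = (\<integral>\<^sup>+z. f (fst z) \<partial>\<pi>)"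
    using f by (intro nn_integral_distr[OF marg(1)]) simp
  also have "\<dots> \<le> (\<integral>\<^sup>+z. ennreal (d (fst z) (snd z)) \<partial>\<pi>)"
    using AE by (intro nn_integral_mono_AE) (auto intro!: le simp: marg(5))
  finally show "(\<integral>\<^sup>+x. f x \<partial>\<mu>) \<le> (\<integral>\<^sup>+z. ennreal (d (fst z) (snd z)) \<partial>\<pi>)" .
qed

text \<open>
  Mass that a coupling sends to the atom \<open>a k\<close> from outside \<open>B k\<close> travels at least \<open>\<delta>\<close>, and there is at least
  \<open>w k - measure \<mu> (B k)\<close> of it. The factor one half pays for turning the sum of the positive parts of
  these deficits into a sum of absolute values, which is possible because the deficits have a nonnegative
  total.
\<close>

lemma wasserstein_atoms_ge:
  fixes a :: "nat \<Rightarrow> 'a" and B :: "nat \<Rightarrow> 'a set" and w :: "nat \<Rightarrow> real"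
  assumes \<mu>: "prob_space \<mu>"
    and a: "\<And>k. k < L \<Longrightarrow> {a k} \<in> sets \<nu>" "\<And>k. k < L \<Longrightarrow> ennreal (w k) \<le> emeasure \<nu> {a k}" "inj_on a {..<L}"
    and w: "(\<Sum>k<L. w k) = 1"
    and B: "\<And>k. k < L \<Longrightarrow> B k \<in> sets \<mu>" "disjoint_family_on B {..<L}"
    and far: "\<And>k x. k < L \<Longrightarrow> x \<in> space \<mu> \<Longrightarrow> x \<notin> B k \<Longrightarrow> \<delta> \<le> d x (a k)" and \<delta>: "0 \<le> \<delta>"
  shows "ennreal (\<delta> / 2 * (\<Sum>k<L. \<bar>measure \<mu> (B k) - w k\<bar>)) \<le> wasserstein d \<mu> \<nu>"
  unfolding wasserstein_def
proof (rule INF_greatest)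
  fix \<pi> assume \<pi>: "\<pi> \<in> couplings \<mu> \<nu>"
  note marg = coupling_marginals[OF \<pi>]
  interpret \<mu>: prob_space \<mu> by (rule \<mu>)
  interpret \<pi>: prob_space \<pi>
    using marg(1,3) \<mu> by (metis prob_space_distrD)
  define E where "E k = (snd -` {a k} \<inter> space \<pi>) - (fst -` B k \<inter> space \<pi>)" for k
  have sets1: "fst -` B k \<inter> space \<pi> \<in> sets \<pi>" if "k < L" for k
    using that by (intro measurable_sets[OF marg(1)] B)
  have sets2: "snd -` {a k} \<inter> space \<pi> \<in> sets \<pi>" if "k < L" for k
    using that by (intro measurable_sets[OF marg(2)] a)
  have E: "E k \<in> sets \<pi>" if "k < L" for k
    using sets1 sets2 that by (auto simp: E_def)
  have missed: "w k - measure \<mu> (B k) \<le> measure \<pi> (E k)" if k: "k < L" for k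
  proof -
    have "ennreal (w k) \<le> emeasure \<pi> (snd -` {a k} \<inter> space \<pi>)"
      using a(2)[OF k] emeasure_distr[OF marg(2) a(1)[OF k]] by (simp add: marg)
    then have "w k \<le> measure \<pi> (snd -` {a k} \<inter> space \<pi>)"
      by (simp add: \<pi>.emeasure_eq_measure)
    also have "\<dots> \<le> measure \<pi> (E k \<union> (fst -` B k \<inter> space \<pi>))"
      using k by (intro \<pi>.finite_measure_mono sets.Un E sets1) (auto simp: E_def)
    also have "\<dots> \<le> measure \<pi> (E k) + measure \<pi> (fst -` B k \<inter> space \<pi>)"
      using k by (intro measure_Un_le E sets1)
    also have "measure \<pi> (fst -` B k \<inter> space \<pi>) = measure \<mu> (B k)"
      using measure_distr[OF marg(1) B(1)[OF k]] by (simp add: marg)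
    finally show ?thesis by simp
  qed
  have "(\<Sum>k<L. measure \<mu> (B k)) = measure \<mu> (\<Union>k<L. B k)"
    using B by (intro \<mu>.finite_measure_finite_Union[symmetric]) auto
  also have "\<dots> \<le> 1" by simp
  finally have mass: "(\<Sum>k<L. measure \<mu> (B k)) \<le> (\<Sum>k<L. w k)" by (simp add: w)
  have "(\<Sum>k<L. \<bar>measure \<mu> (B k) - w k\<bar>) \<le>
    (\<Sum>k<L. 2 * measure \<pi> (E k) + (measure \<mu> (B k) - w k))"
  proof (rule sum_mono)
    fix k assume "k \<in> {..<L}"
    then show "\<bar>measure \<mu> (B k) - w k\<bar> \<le> 2 * measure \<pi> (E k) + (measure \<mu> (B k) - w k)"
      using missed[of k] measure_nonneg[of \<pi> "E k"] unfolding lessThan_iff by linarith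
  qed
  also have "\<dots> \<le> 2 * (\<Sum>k<L. measure \<pi> (E k))"
    using mass by (simp add: sum.distrib sum_subtractf sum_distrib_left)
  finally have "\<delta> / 2 * (\<Sum>k<L. \<bar>measure \<mu> (B k) - w k\<bar>) \<le> \<delta> / 2 * (2 * (\<Sum>k<L. measure \<pi> (E k)))"
    using \<delta> by (intro mult_left_mono) auto
  also have "\<dots> = \<delta> * (\<Sum>k<L. measure \<pi> (E k))" by simp
  finally have "\<delta> / 2 * (\<Sum>k<L. \<bar>measure \<mu> (B k) - w k\<bar>) \<le> \<delta> * (\<Sum>k<L. measure \<pi> (E k))" .
  then have "ennreal (\<delta> / 2 * (\<Sum>k<L. \<bar>measure \<mu> (B k) - w k\<bar>)) \<le> ennreal (\<delta> * (\<Sum>k<L. measure \<pi> (E k)))"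
    by (rule ennreal_leI)
  also have "\<dots> = (\<Sum>k<L. ennreal \<delta> * emeasure \<pi> (E k))"
    using \<delta> by (simp add: ennreal_mult' sum_ennreal[symmetric] \<pi>.emeasure_eq_measure sum_distrib_left)
  also have "\<dots> = (\<Sum>k<L. \<integral>\<^sup>+z. ennreal \<delta> * indicator (E k) z \<partial>\<pi>)"
    using E by (intro sum.cong refl nn_integral_cmult_indicator[symmetric]) auto
  also have "\<dots> = (\<integral>\<^sup>+z. (\<Sum>k<L. ennreal \<delta> * indicator (E k) z) \<partial>\<pi>)"
    using E by (intro nn_integral_sum[symmetric]) auto
  also have "\<dots> \<le> (\<integral>\<^sup>+z. ennreal (d (fst z) (snd z)) \<partial>\<pi>)"
  proof (rule nn_integral_mono)
    fix z assume z: "z \<in> space \<pi>"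
    show "(\<Sum>k<L. ennreal \<delta> * indicator (E k) z) \<le> ennreal (d (fst z) (snd z))"
    proof (cases "\<exists>k<L. z \<in> E k")
      case True
      then obtain k where k: "k < L" "z \<in> E k" by auto
      have other: "z \<notin> E k'" if "k' < L" "k' \<noteq> k" for k'
        using that k a(3) by (auto simp: E_def inj_on_def)
      have "(\<Sum>k<L. ennreal \<delta> * indicator (E k) z) = (\<Sum>k'<L. if k' = k then ennreal \<delta> else 0)"
        using k other by (intro sum.cong) auto
      also have "\<dots> = ennreal \<delta>" using k by simp
      also have "\<dots> \<le> ennreal (d (fst z) (snd z))"
        using k far[of k "fst z"] z by (intro ennreal_leI) (auto simp: E_def marg(5))
      finally show ?thesis .
    next
      case False
      then have "(\<Sum>k<L. ennreal \<delta> * indicator (E k) z) = 0" by (intro sum.neutral) auto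
      then show ?thesis by (simp only: zero_le)
    qed
  qed
  finally show "ennreal (\<delta> / 2 * (\<Sum>k<L. \<bar>measure \<mu> (B k) - w k\<bar>)) \<le>
    (\<integral>\<^sup>+z. ennreal (d (fst z) (snd z)) \<partial>\<pi>)" .
qed

lemma estimatorD:
  assumes "est \<in> estimators p d"
  shows "prob_space (est Y)" "sets (est Y) = sets (borel_metric (prob_simplex p) d)"
proof -
  have "est Y \<in> space (prob_algebra (borel_metric (prob_simplex p) d))"
    using assms unfolding estimators_def by (rule measurable_space) simp
  then show "prob_space (est Y)" "sets (est Y) = sets (borel_metric (prob_simplex p) d)"
    by (auto simp: space_prob_algebra)
qed

section \<open>Condition number and distance of topics\<close>

lemma kappa_nonneg:
  assumes "0 < dim_col B" "0 < m"
  shows "0 \<le> kappa B m"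
  unfolding kappa_def
proof (rule cInf_greatest)
  have "unit_vec (dim_col B) 0 \<in> kappa_cone (dim_col B) {0}"
    using assms by (auto simp: kappa_cone_def intro!: sum.neutral)
  moreover have "{0} \<subseteq> {..<dim_col B}" "card {0::nat} \<le> m" using assms by auto
  ultimately show "{norm_l1 (B *\<^sub>v v) / norm_l1 v |S v. S \<subseteq> {..<dim_col B} \<and> card S \<le> m \<and> v \<in> kappa_cone (dim_col B) S} \<noteq> {}"
    by blast
qed (auto simp: norm_l1_def intro!: divide_nonneg_nonneg sum_nonneg)

text \<open>
  The difference of two unit vectors has half of its 1-norm on one coordinate and therefore lies in the cone
  of a singleton. Dropping rows only decreases the norm of its image.
\<close>

lemma kappa_submatrix_le:
  assumes J: "J \<subseteq> {..<dim_row A}" and k: "k < dim_col A" "k' < dim_col A" "k \<noteq> k'" and m: "1 \<le> m"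
  shows "kappa (submatrix A J UNIV) m \<le> norm_l1 (col A k - col A k') / 2"
proof -
  define B where "B = submatrix A J UNIV"
  have dc: "dim_col B = dim_col A" by (simp add: B_def dim_submatrix)
  have "{i. i < dim_row A \<and> i \<in> J} = J" using J by auto
  then have dr: "dim_row B = card J" by (simp add: B_def dim_submatrix)
  define v where "v = unit_vec (dim_col A) k - (unit_vec (dim_col A) k' :: real vec)"
  have v: "v \<in> carrier_vec (dim_col A)" "\<And>t. t < dim_col A \<Longrightarrow> v $ t = (if t = k then 1 else 0) - (if t = k' then 1 else 0)"
    using k by (auto simp: v_def)
  have abs_v: "\<bar>v $ t\<bar> = (if t = k then 1 else 0) + (if t = k' then 1 else 0)" if "t < dim_col A" for t
    using that k v by auto
  have "norm_l1 v = (\<Sum>t<dim_col A. (if t = k then 1 else 0) + (if t = k' then 1 else 0))"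
    using v(1) unfolding norm_l1_def by (intro sum.cong) (simp_all add: abs_v)
  then have norm_v: "norm_l1 v = 2"
    using k by (simp add: sum.distrib)
  have "(\<Sum>t\<in>{..<dim_col A} - {k}. \<bar>v $ t\<bar>) = (\<Sum>t\<in>{..<dim_col A} - {k}. if t = k' then 1 else 0)"
    by (rule sum.cong) (auto simp: abs_v)
  moreover have "v \<noteq> 0\<^sub>v (dim_col A)"
    using v(2)[of k] k by auto
  ultimately have "v \<in> kappa_cone (dim_col B) {k}"
    using v(1) k abs_v[of k] by (auto simp: kappa_cone_def dc)
  then have "norm_l1 (B *\<^sub>v v) / norm_l1 v \<in>
    {norm_l1 (B *\<^sub>v v) / norm_l1 v |S v. S \<subseteq> {..<dim_col B} \<and> card S \<le> m \<and> v \<in> kappa_cone (dim_col B) S}"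
    using k m dc by (intro CollectI exI[of _ "{k}"] exI[of _ v]) auto
  then have "kappa B m \<le> norm_l1 (B *\<^sub>v v) / norm_l1 v"
    unfolding kappa_def
    by (rule cInf_lower) (auto intro!: bdd_belowI[of _ 0] divide_nonneg_nonneg sum_nonneg simp: norm_l1_def)
  also have "norm_l1 (B *\<^sub>v v) \<le> norm_l1 (col A k - col A k')"
  proof -
    have pick: "pick J i \<in> J" if "i < card J" for i using that by (rule pick_in_set_le)
    have inj: "inj_on (pick J) {..<card J}"
    proof (rule linorder_inj_onI')
      fix i j assume "i \<in> {..<card J}" "j \<in> {..<card J}" "i < j"
      then show "pick J i \<noteq> pick J j" using pick_mono_le[of j J i] by auto
    qed
    have entry: "(B *\<^sub>v v) $ i = A $$ (pick J i, k) - A $$ (pick J i, k')" if "i < card J" for i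
    proof -
      have "(B *\<^sub>v v) $ i = (\<Sum>t<dim_col A. B $$ (i, t) * v $ t)"
        using that v dr dc by (simp add: scalar_prod_def lessThan_atLeast0)
      also have "\<dots> = (\<Sum>t<dim_col A. (if t = k then B $$ (i, t) else 0) - (if t = k' then B $$ (i, t) else 0))"
        by (intro sum.cong) (auto simp: v)
      also have "\<dots> = B $$ (i, k) - B $$ (i, k')"
        using k by (simp add: sum_subtractf)
      also have "\<dots> = A $$ (pick J i, k) - A $$ (pick J i, k')"
        using that k dr dc by (simp add: B_def dim_submatrix submatrix_index pick_UNIV)
      finally show ?thesis .
    qed
    have dim_Bv: "dim_vec (B *\<^sub>v v) = card J" by (simp add: dr)
    have dim_Bv: "dim_vec (B *\<^sub>v v) = card J" by (simp add: dr)
    have dim_Bv: "dim_vec (B *\<^sub>v v) = card J" by (simp add: dr)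
    have dim_Bv: "dim_vec (B *\<^sub>v v) = card J" by (simp add: dr)
    have "norm_l1 (B *\<^sub>v v) = (\<Sum>i<card J. \<bar>A $$ (pick J i, k) - A $$ (pick J i, k')\<bar>)"
      unfolding norm_l1_def dim_Bv
      by (intro sum.cong refl) (simp add: entry del: index_mult_mat_vec)
    also have "\<dots> = (\<Sum>j\<in>pick J ` {..<card J}. \<bar>A $$ (j, k) - A $$ (j, k')\<bar>)"
      by (simp add: sum.reindex[OF inj])
    also have "\<dots> \<le> (\<Sum>j<dim_row A. \<bar>A $$ (j, k) - A $$ (j, k')\<bar>)"
      using pick J by (intro sum_mono2) auto
    also have "\<dots> = norm_l1 (col A k - col A k')"
      using k by (simp add: norm_l1_def)
    finally show ?thesis .
  qed
  finally show ?thesis by (simp add: B_def norm_v divide_right_mono)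
qed

lemma unit_vec_sparse_simplex:
  assumes "k < K" "1 \<le> \<tau>"
  shows "unit_vec K k \<in> sparse_simplex K \<tau>"
proof -
  have "{j. j < K \<and> unit_vec K k $ j \<noteq> (0::real)} = {k}"
    using assms by (auto split: if_splits)
  then show ?thesis
    using assms by (auto simp: sparse_simplex_def prob_simplex_def norm_l0_def)
qed

text \<open>
  The pure topic \<open>k\<close> is a candidate in the minimum over the proportions.
\<close>

lemma kappa_bar_le:
  assumes k: "k < dim_col A" "k' < dim_col A" "k \<noteq> k'" and \<tau>: "1 \<le> \<tau>"
  shows "kappa_bar \<tau> A \<le> norm_l1 (col A k - col A k') / 2"
proof -
  let ?e = "unit_vec (dim_col A) k :: real vec"
  have support: "1 \<le> norm_l0 \<alpha>" if "\<alpha> \<in> prob_simplex (dim_col A)" for \<alpha>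
  proof (rule ccontr)
    assume "\<not> 1 \<le> norm_l0 \<alpha>"
    then have "card {j. j < dim_vec \<alpha> \<and> \<alpha> $ j \<noteq> 0} = 0"
      unfolding norm_l0_def by linarith
    then have "{j. j < dim_vec \<alpha> \<and> \<alpha> $ j \<noteq> 0} = {}"
      by (rule card_0_eq[THEN iffD1, rotated]) simp
    then have "(\<Sum>j<dim_col A. \<alpha> $ j) = 0"
      using that by (intro sum.neutral) (auto simp: prob_simplex_def)
    then show False using that by (simp add: prob_simplex_def)
  qed
  have "kappa_bar \<tau> A \<le> kappa (submatrix A (support_words A ?e) UNIV) (norm_l0 ?e)"
    unfolding kappa_bar_def
  proof (rule cINF_lower)
    show "bdd_below ((\<lambda>\<alpha>. kappa (submatrix A (support_words A \<alpha>) UNIV) (norm_l0 \<alpha>)) ` sparse_simplex (dim_col A) \<tau>)"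
    proof (rule bdd_belowI2)
      fix \<alpha> assume "\<alpha> \<in> sparse_simplex (dim_col A) \<tau>"
      then show "0 \<le> kappa (submatrix A (support_words A \<alpha>) UNIV) (norm_l0 \<alpha>)"
        using support[of \<alpha>] k(1) by (intro kappa_nonneg) (auto simp: dim_submatrix sparse_simplex_def)
    qed
  qed (use k \<tau> unit_vec_sparse_simplex in auto)
  also have "\<dots> \<le> norm_l1 (col A k - col A k') / 2"
    using support[of ?e] unit_vec_sparse_simplex[of k "dim_col A" 1] k
    by (intro kappa_submatrix_le) (auto simp: support_words_def sparse_simplex_def)
  finally show ?thesis .
qed

section \<open>Models with a prescribed document\<close>

text \<open>
  Document \<open>i\<close> has proportions \<open>\<alpha>\<close>. The other documents, numbered consecutively from 1, are pure, and
  document number \<open>k\<close> is about topic \<open>k\<close>, or about the last topic when there are no topics left. For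
  \<open>K \<ge> 2\<close>, topic 0 thus occurs at most in document \<open>i\<close>.
\<close>

definition proportions :: "nat \<Rightarrow> nat \<Rightarrow> nat \<Rightarrow> real vec \<Rightarrow> real mat" where
  "proportions K n i \<alpha> = mat K n (\<lambda>(k, l). if l = i then \<alpha> $ k
     else if k = min (if l < i then Suc l else l) (K - 1) then 1 else 0)"

lemma proportions_carrier: "proportions K n i \<alpha> \<in> carrier_mat K n"
  by (simp add: proportions_def)

lemma col_proportions:
  assumes "i < n" "\<alpha> \<in> carrier_vec K"
  shows "col (proportions K n i \<alpha>) i = \<alpha>"
  using assms by (intro eq_vecI) (auto simp: proportions_def)

lemma col_proportions_other:
  assumes "l < n" "l \<noteq> i"
  shows "col (proportions K n i \<alpha>) l = unit_vec K (min (if l < i then Suc l else l) (K - 1))"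
  using assms by (intro eq_vecI) (auto simp: proportions_def)

text \<open>
  The columns contain \<open>\<alpha>\<close> and the unit vectors \<open>1, \<dots>, K - 1\<close>. Together they form a lower triangular matrix with
  determinant \<open>\<alpha> $ 0\<close>.
\<close>

lemma rank_proportions:
  assumes \<alpha>: "\<alpha> \<in> carrier_vec K" "\<alpha> $ 0 \<noteq> 0" and K: "0 < K" "K \<le> n" and i: "i < n"
  shows "vec_space.rank K (proportions K n i \<alpha>) = K"
proof -
  interpret vec_space "TYPE(real)" K .
  let ?T = "proportions K n i \<alpha>"
  define B where "B = mat K K (\<lambda>(j, k). if k = 0 then \<alpha> $ j else if j = k then 1 else 0)"
  have B: "B \<in> carrier_mat K K" by (simp add: B_def)
  have "det B = (\<Prod>j\<in>{0..<K}. B $$ (j, j))"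
    using B by (subst det_lower_triangular[OF _ B]) (auto simp: B_def prod_list_diag_prod)
  also have "\<dots> \<noteq> 0"
    using \<alpha> by (auto simp: B_def)
  finally have rank_B: "rank B = K"
    by (rule low_rank_det_zero[OF B])
  have distinct: "distinct (cols B)"
    using non_distinct_low_rank[OF B] rank_B by auto
  have indpt: "lin_indpt (set (cols B))"
    by (rule full_rank_lin_indpt[OF B rank_B distinct])
  have sub: "set (cols B) \<subseteq> set (cols ?T)"
  proof
    fix v assume "v \<in> set (cols B)"
    then obtain k where k: "k < K" "v = col B k" using B by (auto simp: cols_def)
    have dim: "dim_col ?T = n" by (simp add: proportions_def)
    show "v \<in> set (cols ?T)"
    proof (cases "k = 0")
      case True
      then have "v = col ?T i"
        using k \<alpha> i by (intro eq_vecI) (auto simp: B_def proportions_def)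
      then show ?thesis using i by (auto simp: cols_def dim)
    next
      case False
      define l where "l = (if k \<le> i then k - 1 else k)"
      have l: "l < n" "l \<noteq> i" "(if l < i then Suc l else l) = k"
        using False k K by (auto simp: l_def)
      have "v = col ?T l"
        unfolding col_proportions_other[OF l(1,2)] l(3)
        using k False by (intro eq_vecI) (auto simp: B_def)
      then show ?thesis using l by (auto simp: cols_def dim)
    qed
  qed
  have "card (set (cols B)) = K"
    using distinct_card[OF distinct] B by simp
  then have ge: "K \<le> rank ?T"
    using rank_ge_card_indpt[OF proportions_carrier sub indpt] by simp
  have carrier: "set (cols ?T) \<subseteq> carrier_vec K"
    using cols_dim[of ?T] by (simp add: proportions_def)
  obtain U where U: "maximal U (\<lambda>X. X \<subseteq> set (cols ?T) \<and> lin_indpt X)"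
    using maximal_exists_superset[of "set (cols ?T)" "\<lambda>X. X \<subseteq> set (cols ?T) \<and> lin_indpt X" "set (cols B)"]
      sub indpt by auto
  then have "rank ?T = card U"
    by (rule rank_card_indpt[OF proportions_carrier])
  moreover have "card U \<le> dim"
    using U carrier by (intro li_le_dim fin_dim) (auto simp: maximal_def)
  ultimately show ?thesis using ge by (simp add: dim_is_n)
qed

lemma topic_models_proportions:
  assumes A: "A \<in> topic_matrices c c' p K" and \<alpha>: "\<alpha> \<in> prob_simplex K" "\<alpha> $ 0 \<noteq> 0"
    and K: "0 < K" "K \<le> n" and i: "i < n"
  shows "(A, proportions K n i \<alpha>) \<in> topic_models c c' p K n"
proof -
  have c: "\<alpha> \<in> carrier_vec K" using \<alpha> by (simp add: prob_simplex_def)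
  have "col (proportions K n i \<alpha>) l \<in> prob_simplex K" if "l < n" for l
  proof (cases "l = i")
    case True
    then show ?thesis using \<alpha>(1) by (simp only: col_proportions[OF i c])
  next
    case False
    have "min (if l < i then Suc l else l) (K - 1) < K" using K(1) by linarith
    then have "unit_vec K (min (if l < i then Suc l else l) (K - 1)) \<in> sparse_simplex K 1"
      by (rule unit_vec_sparse_simplex) simp
    then show ?thesis
      unfolding col_proportions_other[OF that False] by (simp add: sparse_simplex_def)
  qed
  then show ?thesis
    unfolding topic_models_def using A rank_proportions[OF c \<alpha>(2) K i]
    by (simp add: proportions_carrier)
qed

text \<open>
  Word \<open>k < K\<close> is the only anchor of topic \<open>k\<close>, the words from \<open>K\<close> on are shared by all topics. Each topic is
  a weight vector over its anchor, at index 0, followed by the shared words; it is \<open>w\<close> for topic 0 and uniform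
  for the others.
\<close>

definition one_topic_matrix :: "nat \<Rightarrow> nat \<Rightarrow> (nat \<Rightarrow> real) \<Rightarrow> real mat" where
  "one_topic_matrix p K w = mat p K (\<lambda>(j, k).
     let v = (if k = 0 then w else (\<lambda>_. 1 / real (p - K + 1)))
     in if j < K then (if j = k then v 0 else 0) else v (j - K + 1))"

lemma one_topic_matrix_carrier: "one_topic_matrix p K w \<in> carrier_mat p K"
  by (simp add: one_topic_matrix_def)

text \<open>
  The shared words have at least two topics with positive entries, so they are not anchors, and the
  number \<open>K\<close> of anchors is at most \<open>p / 2\<close>.
\<close>

lemma one_topic_matrix_topic_matrices:
  assumes K: "2 \<le> K" "2 * K \<le> p" and L: "L = p - K + 1"
    and w: "\<And>t. t < L \<Longrightarrow> 1 / (2 * real L) \<le> w t" "(\<Sum>t<L. w t) = 1"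
  shows "one_topic_matrix p K w \<in> topic_matrices (1 / 2) (1 / 2) p K"
proof -
  define A where "A = one_topic_matrix p K w"
  have A: "A \<in> carrier_mat p K" by (simp add: A_def one_topic_matrix_carrier)
  have L0: "L > 0" "L \<le> p" "p = K + (L - 1)" using K L by linarith+
  have index: "j - K + 1 < L" if "j < p" "K \<le> j" for j using that L by linarith
  have half: "1 / 2 / real p \<le> 1 / (2 * real L)" using L0(1,2) by (simp add: frac_le)
  define v where "v k = (if k = 0 then w else (\<lambda>_. 1 / real L))" for k :: nat
  have entry: "A $$ (j, k) = (if j < K then (if j = k then v k 0 else 0) else v k (j - K + 1))"
    if "j < p" "k < K" for j k
    using that by (simp add: A_def one_topic_matrix_def v_def L)
  have v: "1 / (2 * real L) \<le> v k t" if "t < L" for k t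
    using w(1)[OF that] L0(1) by (auto simp: v_def field_simps)
  have v_pos: "0 < v k t" if "t < L" for k t
  proof -
    have "0 < 1 / (2 * real L)" using L0 by simp
    then show ?thesis using v[OF that] by (rule less_le_trans)
  qed
  have v1: "(\<Sum>t<L. v k t) = 1" for k
    using w(2) L0(1) by (simp add: v_def)
  have col: "col A k \<in> prob_simplex p" if k: "k < K" for k
  proof -
    have "(\<Sum>j<p. A $$ (j, k)) = (\<Sum>j<K. A $$ (j, k)) + (\<Sum>j=K..<p. A $$ (j, k))"
      using K by (simp add: lessThan_atLeast0 sum.atLeastLessThan_concat)
    also have "(\<Sum>j<K. A $$ (j, k)) = (\<Sum>j<K. if j = k then v k 0 else 0)"
      using k K by (intro sum.cong) (auto simp: entry)
    also have "\<dots> = v k 0" using k by simp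
    also have "(\<Sum>j=K..<p. A $$ (j, k)) = (\<Sum>t<L - 1. v k (Suc t))"
      by (rule sum.reindex_bij_witness[of _ "\<lambda>t. t + K" "\<lambda>j. j - K"]) (use k L0 in \<open>auto simp: entry\<close>)
    also have "v k 0 + \<dots> = (\<Sum>t<Suc (L - 1). v k t)"
      by (rule sum.lessThan_Suc_shift[symmetric])
    also have "\<dots> = 1" using v1 L0(1) by simp
    finally have sum1: "(\<Sum>j<p. A $$ (j, k)) = 1" .
    have "0 \<le> A $$ (j, k)" if "j < p" for j
      using that k L0(1) index[of j] v_pos[of 0 k] v_pos[of "j - K + 1" k] by (auto simp: entry)
    then show ?thesis using sum1 A k by (auto simp: prob_simplex_def)
  qed
  have row: "1 / 2 / real p \<le> norm_linf (row A j)" if j: "j < p" for j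
  proof -
    define k where "k = (if j < K then j else 0)"
    have k: "k < K" using K by (auto simp: k_def)
    have "1 / (2 * real L) \<le> A $$ (j, k)"
      using j k L0(1) index[of j] v[of 0 k] v[of "j - K + 1" k] by (auto simp: entry k_def)
    also have "\<dots> \<le> \<bar>row A j $ k\<bar>" using j k A by simp
    also have "\<dots> \<le> norm_linf (row A j)"
      unfolding norm_linf_def using A k by (intro Max_ge) auto
    finally show ?thesis using half by simp
  qed
  have anchor: "\<exists>j<p. is_anchor A j k" if "k < K" for k
    using that A K v_pos[of 0 k] L0(1) by (intro exI[of _ k]) (auto simp: is_anchor_def entry)
  have "{j. \<exists>k. is_anchor A j k} \<subseteq> {..<K}"
  proof (rule subsetI, rule ccontr)
    fix j assume "j \<in> {j. \<exists>k. is_anchor A j k}" and nj: "j \<notin> {..<K}"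
    then obtain k where "is_anchor A j k" by auto
    note jk = this nj
    then have j: "j < p" "K \<le> j" "k < K" using A by (auto simp: is_anchor_def)
    define k' where "k' = (if k = 0 then 1 else 0 :: nat)"
    have k': "k' < K" "k' \<noteq> k" using K by (auto simp: k'_def)
    have "A $$ (j, k') = 0" using jk(1) k' A by (auto simp: is_anchor_def)
    moreover have "0 < A $$ (j, k')"
      using j k' index[of j] v_pos[of "j - K + 1" k'] by (simp add: entry)
    ultimately show False by simp
  qed
  then have "num_anchors A \<le> K"
    unfolding num_anchors_def using card_mono[of "{..<K}"] by fastforce
  then have "real (num_anchors A) \<le> 1 / 2 * real p"
    using K by simp
  then show ?thesis
    unfolding topic_matrices_def A_def[symmetric] using A col row anchor
    by simp
qed

text \<open>
  The words of topic 0 in the order of its weight vector.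
\<close>

definition word_position :: "nat \<Rightarrow> nat \<Rightarrow> nat" where
  "word_position K t = (if t = 0 then 0 else K + t - 1)"

lemma word_position_less:
  assumes "0 < K" "K \<le> p" "t < p - K + 1"
  shows "word_position K t < p"
  using assms by (auto simp: word_position_def)

lemma inj_word_position: "0 < K \<Longrightarrow> inj (word_position K)"
  by (auto simp: inj_def word_position_def split: if_splits)

lemma col_one_topic_matrix:
  assumes "0 < K" "K \<le> p"
  shows "col (one_topic_matrix p K w) 0 =
    vec p (\<lambda>j. \<Sum>t<p - K + 1. w t * unit_vec p (word_position K t) $ j)"
proof (rule eq_vecI)
  fix j assume "j < dim_vec (vec p (\<lambda>j. \<Sum>t<p - K + 1. w t * unit_vec p (word_position K t) $ j))"
  then have j: "j < p" by simp
  have "(\<Sum>t<p - K + 1. w t * unit_vec p (word_position K t) $ j) =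
    (\<Sum>t<p - K + 1. if word_position K t = j then w t else 0)"
    using j word_position_less[OF assms] by (intro sum.cong) auto
  also have "\<dots> = one_topic_matrix p K w $$ (j, 0)"
  proof (cases "j = 0 \<or> K \<le> j")
    case True
    define t where "t = (if j = 0 then 0 else j - K + 1)"
    have t: "word_position K t' = j \<longleftrightarrow> t' = t" for t'
      using True assms by (auto simp: t_def word_position_def)
    have "t < p - K + 1" using True j assms by (auto simp: t_def)
    then show ?thesis
      using True j assms by (simp add: t) (auto simp: t_def one_topic_matrix_def)
  next
    case False
    then have "word_position K t \<noteq> j" for t by (auto simp: word_position_def)
    then show ?thesis using False j assms by (simp add: one_topic_matrix_def)
  qed
  finally show "col (one_topic_matrix p K w) 0 $ j =
    vec p (\<lambda>j. \<Sum>t<p - K + 1. w t * unit_vec p (word_position K t) $ j) $ j"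
    using j assms by (simp add: one_topic_matrix_def)
qed (simp add: one_topic_matrix_def)

lemma col_one_topic_matrix_other:
  assumes "0 < k" "k < K"
  shows "col (one_topic_matrix p K w) k = col (one_topic_matrix p K w') k"
  using assms by (intro eq_vecI) (auto simp: one_topic_matrix_def)

lemma mult_mat_unit_vec:
  fixes A :: "real mat"
  assumes "A \<in> carrier_mat p K" "k < K"
  shows "A *\<^sub>v unit_vec K k = col A k"
  using assms by (intro eq_vecI) auto

section \<open>The two lower bounds\<close>

lemma sum_even_le:
  fixes f :: "nat \<Rightarrow> real"
  assumes "\<And>k. 0 \<le> f k"
  shows "(\<Sum>b<L div 2. f (2 * b)) \<le> (\<Sum>k<L. f k)"
proof -
  have "(\<Sum>b<L div 2. f (2 * b)) = (\<Sum>k\<in>(*) 2 ` {..<L div 2}. f k)"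
    by (subst sum.reindex) (auto simp: inj_on_def)
  also have "\<dots> \<le> (\<Sum>k<L. f k)"
    by (intro sum_mono2) (auto simp: assms)
  finally show ?thesis .
qed

text \<open>
  A word is an anchor of at most one topic.
\<close>

lemma num_topics_le_num_anchors:
  assumes "A \<in> topic_matrices c c' p K"
  shows "K \<le> num_anchors A"
proof -
  have A: "A \<in> carrier_mat p K" "\<forall>k<K. \<exists>j<p. is_anchor A j k"
    using assms by (auto simp: topic_matrices_def)
  then obtain f where f: "\<And>k. k < K \<Longrightarrow> is_anchor A (f k) k" by metis
  have "inj_on f {..<K}"
  proof (rule inj_onI)
    fix k k' assume k: "k \<in> {..<K}" "k' \<in> {..<K}" "f k = f k'"
    then have "is_anchor A (f k) k" "is_anchor A (f k) k'" using f[of k] f[of k'] by auto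
    then show "k = k'" by (cases "k = k'") (auto simp: is_anchor_def)
  qed
  then have "card (f ` {..<K}) = K" by (simp add: card_image)
  moreover have "card (f ` {..<K}) \<le> card {j. \<exists>k. is_anchor A j k}"
  proof (rule card_mono)
    show "finite {j. \<exists>k. is_anchor A j k}"
      by (rule finite_subset[of _ "{..<dim_row A}"]) (auto simp: is_anchor_def)
    show "f ` {..<K} \<subseteq> {j. \<exists>k. is_anchor A j k}" using f by blast
  qed
  ultimately show ?thesis by (simp add: num_anchors_def)
qed

abbreviation (input) sparse_models :: "real \<Rightarrow> real \<Rightarrow> nat \<Rightarrow> nat \<Rightarrow> nat \<Rightarrow> nat \<Rightarrow> nat \<Rightarrow> (real mat \<times> real mat) set" where
  "sparse_models c c' p K n i \<tau> \<equiv> {(A, T) \<in> topic_models c c' p K n. col T i \<in> sparse_simplex K \<tau>}"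

text \<open>
  The atoms of the mixing measure are the known topics and lie at distance at least \<open>2 * \<delta>\<close>. The mass that an
  estimator puts into the disjoint balls of radius \<open>\<delta>\<close> about them acts as an estimator of the weights.
\<close>

lemma weights_lower_bound:
  assumes A: "A \<in> topic_matrices c c' p K" and \<tau>: "2 \<le> \<tau>" "\<tau> \<le> K" "\<tau> \<le> N" and K: "K \<le> n" and i: "i < n"
    and d: "Metric_space (prob_simplex p) d" and cd: "0 < cd"
    and lower: "\<And>u v. u \<in> prob_simplex p \<Longrightarrow> v \<in> prob_simplex p \<Longrightarrow> cd * norm_l1 (u - v) \<le> 2 * d u v"
    and est: "est \<in> estimators p d"
  shows "ennreal (cd * kappa_bar \<tau> A / 4 * sqrt (real \<tau> / (32 * real N)) / 6) \<le>
    (SUP \<theta>\<in>sparse_models c c' p K n i \<tau>. wasserstein_risk d n N i est \<theta>)"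
proof (cases "kappa_bar \<tau> A \<le> 0")
  case True
  have "cd * kappa_bar \<tau> A / 4 * sqrt (real \<tau> / (32 * real N)) / 6 =
    kappa_bar \<tau> A * (cd / 4 * sqrt (real \<tau> / (32 * real N)) / 6)" by simp
  also have "\<dots> \<le> 0"
    using True cd by (intro mult_nonpos_nonneg) auto
  finally show ?thesis by (simp add: ennreal_neg)
next
  case False
  interpret Metric_space "prob_simplex p" d by (rule d)
  have Ac: "A \<in> carrier_mat p K" and colA: "\<And>k. k < K \<Longrightarrow> col A k \<in> prob_simplex p"
    using A by (auto simp: topic_matrices_def)
  define \<delta> where "\<delta> = cd * kappa_bar \<tau> A / 2"
  have \<delta>: "\<delta> > 0" using False cd by (simp add: \<delta>_def)
  have apart: "2 * \<delta> \<le> d (col A k) (col A k')" if "k < K" "k' < K" "k \<noteq> k'" for k k'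
  proof -
    have "2 * \<delta> \<le> cd * (norm_l1 (col A k - col A k') / 2)"
      using kappa_bar_le[of k A k' \<tau>] that Ac \<tau> cd by (simp add: \<delta>_def)
    also have "\<dots> \<le> d (col A k) (col A k')"
      using lower[OF colA[OF that(1)] colA[OF that(2)]] by simp
    finally show ?thesis .
  qed
  define h where "h = sqrt (real \<tau> / (32 * real N))"
  have N: "N > 0" using \<tau> by simp
  have h: "0 \<le> h" "h \<le> 1 / 2" "h\<^sup>2 \<le> real \<tau> / (32 * real N)"
  proof -
    have "real \<tau> / (32 * real N) \<le> (1 / 2)\<^sup>2"
      using \<tau> N by (simp add: divide_le_eq power2_eq_square)
    then show "h \<le> 1 / 2" unfolding h_def by (rule real_le_lsqrt[rotated]) simp
  qed (simp_all add: h_def)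
  define w where "w = pair_weight \<tau> h"
  have w0: "0 < w S k" for S k
  proof -
    have "0 < 1 / (2 * real \<tau>)" using \<tau> by simp
    then show ?thesis
      unfolding w_def using pair_weight_bounds[OF h(1,2)] \<tau> by (meson less_le_trans zero_less_numeral)
  qed
  have w1: "(\<Sum>k<\<tau>. w S k) = 1" for S
    unfolding w_def using \<tau> by (intro sum_pair_weight) simp
  define \<alpha> where "\<alpha> S = vec K (\<lambda>k. if k < \<tau> then w S k else 0)" for S
  have \<alpha>_simplex: "\<alpha> S \<in> prob_simplex K" for S
  proof -
    have "(\<Sum>k<K. \<alpha> S $ k) = (\<Sum>k<\<tau>. w S k)"
      using \<tau> by (intro sum.mono_neutral_cong_right) (auto simp: \<alpha>_def)
    then show ?thesis using w0 by (auto simp: prob_simplex_def \<alpha>_def w1 less_imp_le)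
  qed
  have \<alpha>_sparse: "\<alpha> S \<in> sparse_simplex K \<tau>" for S
  proof -
    have "norm_l0 (\<alpha> S) \<le> card {..<\<tau>}"
      unfolding norm_l0_def by (intro card_mono) (auto simp: \<alpha>_def split: if_splits)
    then show ?thesis using \<alpha>_simplex by (simp add: sparse_simplex_def)
  qed
  have col_T: "col (proportions K n i (\<alpha> S)) i = \<alpha> S" for S
    using i by (intro col_proportions) (simp_all add: \<alpha>_def)
  define B where "B k = mball (col A k) \<delta>" for k
  define loss where "loss b \<sigma> Y =
    ennreal (\<delta> / 2 * \<bar>measure (est Y) (B (2 * b)) - w (if \<sigma> then {b} else {}) (2 * b)\<bar>)" for b \<sigma> Y
  have "ennreal (\<delta> / 2 * h / 6) \<le>
    (SUP \<theta>\<in>sparse_models c c' p K n i \<tau>. wasserstein_risk d n N i est \<theta>)"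
  proof (rule sup_risk_lower_bound[where A = "\<lambda>_. A" and T = "\<lambda>S. proportions K n i (\<alpha> S)"
        and Q = "col A" and loss = loss and L = \<tau> and p = p])
    fix S
    have "\<alpha> S $ 0 \<noteq> 0" using \<tau> w0[of S 0] by (simp add: \<alpha>_def)
    then have "(A, proportions K n i (\<alpha> S)) \<in> topic_models c c' p K n"
      using A \<alpha>_simplex K i \<tau> by (intro topic_models_proportions) auto
    then show "(A, proportions K n i (\<alpha> S)) \<in> sparse_models c c' p K n i \<tau>"
      using \<alpha>_sparse by (simp add: col_T)
  next
    fix S S' l assume "l < n" "l \<noteq> i"
    then show "A *\<^sub>v col (proportions K n i (\<alpha> S)) l = A *\<^sub>v col (proportions K n i (\<alpha> S')) l"
      by (simp add: col_proportions_other)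
  next
    fix S
    show "A *\<^sub>v col (proportions K n i (\<alpha> S)) i = vec p (\<lambda>j. \<Sum>k<\<tau>. pair_weight \<tau> h S k * col A k $ j)"
      unfolding col_T
    proof (rule eq_vecI)
      fix j assume "j < dim_vec (vec p (\<lambda>j. \<Sum>k<\<tau>. pair_weight \<tau> h S k * col A k $ j))"
      then have j: "j < p" by simp
      have "(A *\<^sub>v \<alpha> S) $ j = (\<Sum>k<K. A $$ (j, k) * \<alpha> S $ k)"
        using j Ac by (simp add: scalar_prod_def lessThan_atLeast0 \<alpha>_def)
      also have "\<dots> = (\<Sum>k<\<tau>. pair_weight \<tau> h S k * col A k $ j)"
        using j Ac \<tau> by (intro sum.mono_neutral_cong_right) (auto simp: \<alpha>_def w_def)
      finally show "(A *\<^sub>v \<alpha> S) $ j = vec p (\<lambda>j. \<Sum>k<\<tau>. pair_weight \<tau> h S k * col A k $ j) $ j"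
        using j by simp
    qed (use Ac in simp)
  next
    fix b Y assume b: "b < \<tau> div 2"
    have "\<delta> / 2 * (2 * h / real \<tau>) \<le> \<delta> / 2 * (\<bar>measure (est Y) (B (2 * b)) - w {} (2 * b)\<bar> +
      \<bar>measure (est Y) (B (2 * b)) - w {b} (2 * b)\<bar>)"
      unfolding w_def using \<delta> \<tau> h b by (intro mult_left_mono pair_weight_separated) auto
    then show "ennreal (\<delta> / 2 * (2 * h / real \<tau>)) \<le> loss b False Y + loss b True Y"
      using \<delta> by (simp add: loss_def distrib_left ennreal_leI flip: ennreal_plus)
  next
    fix S Y
    note est' = estimatorD[OF est, of Y]
    have "(\<Sum>b<\<tau> div 2. loss b (b \<in> S) Y) =
      ennreal (\<Sum>b<\<tau> div 2. \<delta> / 2 * \<bar>measure (est Y) (B (2 * b)) - w S (2 * b)\<bar>)"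
      using \<delta> by (subst sum_ennreal[symmetric]) (auto simp: loss_def w_def pair_weight_even[of \<tau> h S] intro!: sum.cong)
    also have "\<dots> \<le> ennreal (\<delta> / 2 * (\<Sum>k<\<tau>. \<bar>measure (est Y) (B k) - w S k\<bar>))"
      unfolding sum_distrib_left[symmetric] using \<delta>
      by (intro ennreal_leI mult_left_mono sum_even_le) auto
    also have "\<dots> \<le> wasserstein d (est Y) (mixing_measure d A (\<alpha> S))"
    proof (rule wasserstein_atoms_ge[where a = "col A"])
      show "prob_space (est Y)" by (rule est')
      fix k assume k: "k < \<tau>"
      have kK: "k < K" using k \<tau> by simp
      show sets: "{col A k} \<in> sets (mixing_measure d A (\<alpha> S))"
        using Ac singleton_sets_borel_metric[OF colA[OF kK]] by simp
      have "ennreal (w S k) = (\<Sum>k'\<in>{k}. ennreal (\<alpha> S $ k') * indicator {col A k} (col A k'))"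
        using k kK by (simp add: \<alpha>_def)
      also have "\<dots> \<le> (\<Sum>k'<K. ennreal (\<alpha> S $ k') * indicator {col A k} (col A k'))"
        using kK by (intro sum_mono2) auto
      also have "\<dots> = emeasure (mixing_measure d A (\<alpha> S)) {col A k}"
        using Ac d sets by (subst emeasure_mixing_measure) auto
      finally show "ennreal (w S k) \<le> emeasure (mixing_measure d A (\<alpha> S)) {col A k}" .
      show "B k \<in> sets (est Y)"
        unfolding est' B_def by (intro openin_sets_borel_metric openin_mball)
      fix x assume "x \<in> space (est Y)" "x \<notin> B k"
      then show "\<delta> \<le> d x (col A k)"
        using sets_eq_imp_space_eq[OF est'(2)] colA[OF kK] by (auto simp: B_def commute)
    next
      show "inj_on (col A) {..<\<tau>}"
      proof (rule inj_onI, rule ccontr)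
        fix k k' assume k: "k \<in> {..<\<tau>}" "k' \<in> {..<\<tau>}" "col A k = col A k'" "k \<noteq> k'"
        then have "2 * \<delta> \<le> d (col A k) (col A k)" using apart[of k k'] \<tau> by simp
        then show False using \<delta> colA[of k] k \<tau> by simp
      qed
      show "disjoint_family_on B {..<\<tau>}"
        unfolding disjoint_family_on_def
      proof (intro ballI impI)
        fix k k' assume k: "k \<in> {..<\<tau>}" "k' \<in> {..<\<tau>}" "k \<noteq> k'"
        show "B k \<inter> B k' = {}"
        proof (rule ccontr)
          assume "B k \<inter> B k' \<noteq> {}"
          then obtain x where x: "x \<in> prob_simplex p" "d (col A k) x < \<delta>" "d (col A k') x < \<delta>"
            by (auto simp: B_def)
          then have "d (col A k) (col A k') < 2 * \<delta>"
            using triangle[of "col A k" x "col A k'"] colA k \<tau> by (simp add: commute)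
          then show False using apart[of k k'] k \<tau> by simp
        qed
      qed
    qed (use \<delta> w1 in auto)
    finally show "(\<Sum>b<\<tau> div 2. loss b (b \<in> S) Y) \<le>
      wasserstein d (est Y) (mixing_measure d A (col (proportions K n i (\<alpha> S)) i))"
      unfolding col_T .
  qed (use Ac colA i N \<tau> h \<delta> in auto)
  then show ?thesis by (simp add: \<delta>_def h_def)
qed

text \<open>
  The mixing measure of document \<open>i\<close> is the point mass at topic 0. An estimator is itself a measure, and its
  loss for one bit is the integral of a coordinate error; two values of that coordinate that differ by
  \<open>2 * h / L\<close> cannot both be close to any point, hence not on average either.
\<close>

lemma topic_lower_bound:
  fixes p K :: nat
  defines "L \<equiv> p - K + 1"
  assumes K: "2 \<le> K" "2 * K \<le> p" "K \<le> n" and i: "i < n" and N: "0 < N" and \<tau>: "1 \<le> \<tau>"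
    and d: "Metric_space (prob_simplex p) d" and cd: "0 < cd"
    and lower: "\<And>u v. u \<in> prob_simplex p \<Longrightarrow> v \<in> prob_simplex p \<Longrightarrow> cd * norm_l1 (u - v) \<le> 2 * d u v"
    and est: "est \<in> estimators p d"
    and h: "0 \<le> h" "h \<le> 1 / 2" "h\<^sup>2 \<le> real L / (32 * real N)"
  shows "ennreal (cd / 2 * h / 6) \<le>
    (SUP \<theta>\<in>sparse_models (1 / 2) (1 / 2) p K n i \<tau>. wasserstein_risk d n N i est \<theta>)"
proof -
  interpret Metric_space "prob_simplex p" d by (rule d)
  have L: "2 \<le> L" "0 < L" using K by (auto simp: L_def)
  have position: "word_position K t < p" if "t < L" for t
    using word_position_less[of K p t] K that by (simp add: L_def)
  define w where "w = pair_weight L h"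
  define A where "A S = one_topic_matrix p K (w S)" for S
  define e where "e = (unit_vec K 0 :: real vec)"
  have A: "A S \<in> topic_matrices (1 / 2) (1 / 2) p K" for S
    unfolding A_def w_def using K L h
    by (intro one_topic_matrix_topic_matrices[of _ _ L] pair_weight_bounds sum_pair_weight) (auto simp: L_def)
  have Ac: "A S \<in> carrier_mat p K" and colA: "col (A S) 0 \<in> prob_simplex p" for S
    using A[of S] K by (auto simp: topic_matrices_def)
  have e: "e \<in> sparse_simplex K \<tau>" "e \<in> prob_simplex K"
    using unit_vec_sparse_simplex[of 0 K \<tau>] K \<tau> by (auto simp: e_def sparse_simplex_def)
  have col_T: "col (proportions K n i e) i = e"
    using i by (intro col_proportions) (simp_all add: e_def)
  have mult_e: "A S *\<^sub>v e = col (A S) 0" for S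
    unfolding e_def using K by (intro mult_mat_unit_vec[OF Ac]) simp
  have colA_eq: "col (A S) 0 = vec p (\<lambda>j. \<Sum>t<L. w S t * unit_vec p (word_position K t) $ j)" for S
    unfolding A_def L_def using K by (intro col_one_topic_matrix) auto
  have colA_at: "col (A S) 0 $ word_position K t = w S t" if "t < L" for S t
  proof -
    have eq: "word_position K t = word_position K t' \<longleftrightarrow> t = t'" for t'
      using inj_word_position[of K] K by (simp add: inj_eq)
    have "col (A S) 0 $ word_position K t = (\<Sum>t'<L. w S t' * unit_vec p (word_position K t') $ word_position K t)"
      unfolding colA_eq using position[OF that] by simp
    also have "\<dots> = (\<Sum>t'<L. if t' = t then w S t' else 0)"
      using position[OF that] by (intro sum.cong) (auto simp: eq position)
    finally have "col (A S) 0 $ word_position K t = (\<Sum>t'<L. if t' = t then w S t' else 0)" .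
    then show ?thesis using that by simp
  qed
  have coordinate: "(\<lambda>x. x $ j) \<in> borel_measurable (est Y)" if j: "j < p" for j Y
  proof -
    have "(\<lambda>x. x $ j) \<in> borel_measurable (borel_metric (prob_simplex p) d)"
    proof (rule lipschitz_borel_measurable)
      show "0 < 2 / cd" using cd by simp
      fix x y :: "real vec" assume xy: "x \<in> prob_simplex p" "y \<in> prob_simplex p"
      then have dim: "dim_vec x = p" "dim_vec y = p" by (auto simp: prob_simplex_def)
      have "\<bar>x $ j - y $ j\<bar> = \<bar>(x - y) $ j\<bar>" using dim j by simp
      also have "\<dots> \<le> (\<Sum>t<p. \<bar>(x - y) $ t\<bar>)" using j by (intro member_le_sum) auto
      also have "\<dots> = norm_l1 (x - y)" using dim by (simp add: norm_l1_def)
      also have "\<dots> \<le> 2 / cd * d x y"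
        using lower[OF xy] cd by (simp add: field_simps)
      finally show "\<bar>x $ j - y $ j\<bar> \<le> 2 / cd * d x y" .
    qed
    then show ?thesis using measurable_cong_sets[OF estimatorD(2)[OF est] refl] by blast
  qed
  define g where "g b S x = ennreal (cd / 2 * \<bar>x $ word_position K (2 * b) - w S (2 * b)\<bar>)" for b S and x :: "real vec"
  have g: "g b S \<in> borel_measurable (est Y)" if "b < L div 2" for b S Y
  proof -
    have [measurable]: "(\<lambda>x. x $ word_position K (2 * b)) \<in> borel_measurable (est Y)"
      using that by (intro coordinate position) simp
    show ?thesis unfolding g_def by measurable
  qed
  define loss where "loss b \<sigma> Y = (\<integral>\<^sup>+x. g b (if \<sigma> then {b} else {}) x \<partial>est Y)" for b \<sigma> Y
  show ?thesis
  proof (rule sup_risk_lower_bound[where A = A and T = "\<lambda>_. proportions K n i e"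
        and Q = "\<lambda>t. unit_vec p (word_position K t)" and loss = loss and L = L and p = p])
    fix S
    show "(A S, proportions K n i e) \<in> sparse_models (1 / 2) (1 / 2) p K n i \<tau>"
      using topic_models_proportions[OF A e(2) _ _ K(3) i] e K by (simp add: col_T) (simp add: e_def)
  next
    fix S S' l assume l: "l < n" "l \<noteq> i"
    define k where "k = min (if l < i then Suc l else l) (K - 1)"
    have k: "0 < k" "k < K" using K l by (auto simp: k_def)
    have "A S *\<^sub>v col (proportions K n i e) l = col (A S) k" for S
      unfolding col_proportions_other[OF l] k_def[symmetric] by (rule mult_mat_unit_vec[OF Ac k(2)])
    then show "A S *\<^sub>v col (proportions K n i e) l = A S' *\<^sub>v col (proportions K n i e) l"
      unfolding A_def using col_one_topic_matrix_other[OF k] by simp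
  next
    fix t assume "t < L"
    then show "unit_vec p (word_position K t) \<in> prob_simplex p"
      using unit_vec_sparse_simplex[OF position, of t 1] by (simp add: sparse_simplex_def)
  next
    fix S
    show "A S *\<^sub>v col (proportions K n i e) i =
      vec p (\<lambda>j. \<Sum>t<L. pair_weight L h S t * unit_vec p (word_position K t) $ j)"
      unfolding col_T mult_e colA_eq w_def ..
  next
    fix b Y assume b: "b < L div 2"
    interpret est: prob_space "est Y" by (rule estimatorD[OF est])
    have "ennreal (cd / 2 * (2 * h / real L)) = (\<integral>\<^sup>+x. ennreal (cd / 2 * (2 * h / real L)) \<partial>est Y)"
      by (simp add: est.emeasure_space_1)
    also have "\<dots> \<le> (\<integral>\<^sup>+x. g b {} x + g b {b} x \<partial>est Y)"
    proof (rule nn_integral_mono)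
      fix x :: "real vec"
      have "cd / 2 * (2 * h / real L) \<le> cd / 2 * (\<bar>x $ word_position K (2 * b) - w {} (2 * b)\<bar> +
        \<bar>x $ word_position K (2 * b) - w {b} (2 * b)\<bar>)"
        unfolding w_def using cd L h b by (intro mult_left_mono pair_weight_separated) auto
      then show "ennreal (cd / 2 * (2 * h / real L)) \<le> g b {} x + g b {b} x"
        using cd by (simp add: g_def distrib_left ennreal_leI flip: ennreal_plus)
    qed
    also have "\<dots> = loss b False Y + loss b True Y"
      unfolding loss_def using b by (subst nn_integral_add) (simp_all add: g)
    finally show "ennreal (cd / 2 * (2 * h / real L)) \<le> loss b False Y + loss b True Y" .
  next
    fix S Y
    have "(\<Sum>b<L div 2. loss b (b \<in> S) Y) = (\<Sum>b<L div 2. \<integral>\<^sup>+x. g b S x \<partial>est Y)"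
      by (simp add: loss_def g_def w_def pair_weight_even[of L h S])
    also have "\<dots> = (\<integral>\<^sup>+x. (\<Sum>b<L div 2. g b S x) \<partial>est Y)"
      by (rule nn_integral_sum[symmetric]) (simp add: g)
    also have "\<dots> \<le> wasserstein d (est Y) (mixing_measure d (A S) e)"
    proof (rule wasserstein_dirac_ge[where a = "col (A S) 0"])
      show "(\<lambda>x. \<Sum>b<L div 2. g b S x) \<in> borel_measurable (est Y)"
        by (intro borel_measurable_sum g) simp
      show sets: "{col (A S) 0} \<in> sets (mixing_measure d (A S) e)"
        using Ac[of S] singleton_sets_borel_metric[OF colA] by simp
      have "space (mixing_measure d (A S) e) - {col (A S) 0} \<in> sets (mixing_measure d (A S) e)"
        using sets by (rule sets.compl_sets)
      then show "emeasure (mixing_measure d (A S) e) (space (mixing_measure d (A S) e) - {col (A S) 0}) = 0"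
        using Ac[of S] d by (subst emeasure_mixing_measure) (auto simp: e_def indicator_def intro!: sum.neutral)
      fix x assume "x \<in> space (est Y)"
      then have x: "x \<in> prob_simplex p"
        using sets_eq_imp_space_eq[OF estimatorD(2)[OF est]] by auto
      then have dim: "dim_vec x = p" by (simp add: prob_simplex_def)
      have "(\<Sum>b<L div 2. g b S x) =
        ennreal (\<Sum>b<L div 2. cd / 2 * \<bar>x $ word_position K (2 * b) - w S (2 * b)\<bar>)"
        unfolding g_def using cd by (intro sum_ennreal) auto
      also have "\<dots> \<le> ennreal (d x (col (A S) 0))"
      proof (rule ennreal_leI)
        have "(\<Sum>b<L div 2. cd / 2 * \<bar>x $ word_position K (2 * b) - w S (2 * b)\<bar>) \<le>
          cd / 2 * (\<Sum>t<L. \<bar>x $ word_position K t - w S t\<bar>)"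
          unfolding sum_distrib_left[symmetric] using cd by (intro mult_left_mono sum_even_le) auto
        also have "(\<Sum>t<L. \<bar>x $ word_position K t - w S t\<bar>) =
          (\<Sum>j\<in>word_position K ` {..<L}. \<bar>x $ j - col (A S) 0 $ j\<bar>)"
          using inj_word_position[of K] K
          by (subst sum.reindex) (auto simp: colA_at inj_def inj_on_def)
        also have "\<dots> \<le> (\<Sum>j<p. \<bar>x $ j - col (A S) 0 $ j\<bar>)"
          by (intro sum_mono2) (auto simp: position)
        also have "\<dots> = norm_l1 (x - col (A S) 0)"
          unfolding norm_l1_def using Ac[of S] by (intro sum.cong) auto
        also have "cd / 2 * \<dots> \<le> d x (col (A S) 0)"
          using lower[OF x colA[of S]] by simp
        finally show "(\<Sum>b<L div 2. cd / 2 * \<bar>x $ word_position K (2 * b) - w S (2 * b)\<bar>) \<le> d x (col (A S) 0)"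
          using cd by (simp add: mult_left_mono)
      qed
      finally show "(\<Sum>b<L div 2. g b S x) \<le> ennreal (d x (col (A S) 0))" .
    qed
    finally show "(\<Sum>b<L div 2. loss b (b \<in> S) Y) \<le>
      wasserstein d (est Y) (mixing_measure d (A S) (col (proportions K n i e) i))"
      unfolding col_T .
  qed (use Ac L i N h cd in auto)
qed

theorem theorem11:
  shows "\<exists>c c' c1 c2 c3 :: real.
    0 < c \<and> c < 1 \<and> 0 < c' \<and> 0 < c1 \<and> 0 < c2 \<and> 0 < c3 \<and>
    (\<forall>(n::nat) (N::nat) (p::nat) (K::nat) (\<tau>::nat) (i::nat)
      (d :: real vec \<Rightarrow> real vec \<Rightarrow> real) (cd::real) (Cd::real) (A0::real mat).
      0 < n \<and> 0 < N \<and> 0 < p \<and> 0 < K \<and> 1 < \<tau> \<and> \<tau> \<le> K \<and> K \<le> n \<and>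
      real \<tau> \<le> c1 * real N \<and> real p * real K \<le> c2 * (real n * real N) \<and>
      i < n \<and>
      Metric_space (prob_simplex p) d \<and> 0 < cd \<and> cd \<le> Cd \<and>
      (\<forall>u\<in>prob_simplex p. \<forall>v\<in>prob_simplex p.
         cd * norm_l1 (u - v) \<le> 2 * d u v \<and> 2 * d u v \<le> Cd * norm_l1 (u - v)) \<and>
      A0 \<in> topic_matrices c c' p K
      \<longrightarrow>
      (INF est\<in>estimators p d.
         SUP \<theta>\<in>{(A, T) \<in> topic_models c c' p K n. col T i \<in> sparse_simplex K \<tau>}.
           wasserstein_risk d n N i est \<theta>)
      \<ge> ennreal (c3 * cd * (kappa_bar \<tau> A0 * sqrt (real \<tau> / real N)
                            + sqrt (real p * real K / (real n * real N)))))"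
proof (rule exI[of _ "1 / 2"], rule exI[of _ "1 / 2"], rule exI[of _ 1], rule exI[of _ 1],
    rule exI[of _ "1 / 300"], intro conjI allI impI; (elim conjE)?)
  fix n N p K \<tau> i :: nat and d :: "real vec \<Rightarrow> real vec \<Rightarrow> real" and cd Cd :: real and A0 :: "real mat"
  assume pos: "0 < n" "0 < N" and \<tau>: "1 < \<tau>" "\<tau> \<le> K" and K: "K \<le> n"
    and \<tau>N: "real \<tau> \<le> 1 * real N" and pK: "real p * real K \<le> 1 * (real n * real N)" and i: "i < n"
    and d: "Metric_space (prob_simplex p) d" and cd: "0 < cd"
    and equiv: "\<forall>u\<in>prob_simplex p. \<forall>v\<in>prob_simplex p.
         cd * norm_l1 (u - v) \<le> 2 * d u v \<and> 2 * d u v \<le> Cd * norm_l1 (u - v)"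
    and A0: "A0 \<in> topic_matrices (1 / 2) (1 / 2) p K"
  \<comment> \<open>The constants: \<open>R1\<close> and \<open>R2\<close> below are at least \<open>cd * X1 / 144\<close> (if \<open>kappa_bar \<tau> A0 > 0\<close>) and \<open>cd * X2 / 96\<close>, and
    \<open>144 / 300 + 96 / 300 \<le> 1\<close>.\<close>
  define X1 where "X1 = kappa_bar \<tau> A0 * sqrt (real \<tau> / real N)"
  define X2 where "X2 = sqrt (real p * real K / (real n * real N))"
  define L where "L = p - K + 1"
  define h where "h = min (1 / 2) (sqrt (real L / (32 * real N)))"
  have lower: "cd * norm_l1 (u - v) \<le> 2 * d u v" if "u \<in> prob_simplex p" "v \<in> prob_simplex p" for u v
    using equiv that by blast
  have "real (num_anchors A0) \<le> 1 / 2 * real p"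
    using A0 by (simp add: topic_matrices_def)
  then have Kp: "2 * K \<le> p"
    using num_topics_le_num_anchors[OF A0] by linarith
  have h: "0 \<le> h" "h \<le> 1 / 2" "h\<^sup>2 \<le> real L / (32 * real N)"
  proof -
    have "h\<^sup>2 \<le> (sqrt (real L / (32 * real N)))\<^sup>2"
      unfolding h_def by (intro power_mono) auto
    then show "h\<^sup>2 \<le> real L / (32 * real N)" by simp
  qed (auto simp: h_def)
  have rate1: "sqrt (real \<tau> / real N) / 6 \<le> sqrt (real \<tau> / (32 * real N))"
  proof -
    have "sqrt (real \<tau> / real N) / 6 = sqrt (real \<tau> / real N / 36)"
      using real_sqrt_unique[of 6 36] by (simp only: real_sqrt_divide) simp
    also have "\<dots> \<le> sqrt (real \<tau> / (32 * real N))"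
      using pos by (intro real_sqrt_le_mono) (simp add: frac_le)
    finally show ?thesis .
  qed
  have rate2: "X2 / 8 \<le> h"
  proof -
    have "real p * real K / (real n * real N) \<le> 1"
      using pK pos by (simp add: divide_le_eq)
    then have "X2 \<le> 1" by (simp add: X2_def)
    moreover have "X2 / 8 \<le> sqrt (real L / (32 * real N))"
    proof -
      have "X2 / 8 = sqrt (real p * real K / (real n * real N) / 64)"
        using real_sqrt_unique[of 8 64] by (simp only: X2_def real_sqrt_divide) simp
      also have "\<dots> \<le> sqrt (real L / (32 * real N))"
      proof (rule real_sqrt_le_mono)
        have "p \<le> 2 * L" using Kp by (simp add: L_def)
        then have "real p * real K \<le> (2 * real L) * real n"
          using K by (intro mult_mono) auto
        then show "real p * real K / (real n * real N) / 64 \<le> real L / (32 * real N)"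
          using pos by (simp add: field_simps)
      qed
      finally show ?thesis .
    qed
    ultimately show ?thesis by (simp add: h_def)
  qed
  show "ennreal (1 / 300 * cd * (kappa_bar \<tau> A0 * sqrt (real \<tau> / real N)
      + sqrt (real p * real K / (real n * real N)))) \<le>
    (INF est\<in>estimators p d.
       SUP \<theta>\<in>{(A, T) \<in> topic_models (1 / 2) (1 / 2) p K n. col T i \<in> sparse_simplex K \<tau>}.
         wasserstein_risk d n N i est \<theta>)"
    unfolding X1_def[symmetric] X2_def[symmetric]
  proof (rule INF_greatest)
    fix est assume est: "est \<in> estimators p d"
    let ?sup = "SUP \<theta>\<in>sparse_models (1 / 2) (1 / 2) p K n i \<tau>. wasserstein_risk d n N i est \<theta>"
    define R1 where "R1 = cd * kappa_bar \<tau> A0 / 4 * sqrt (real \<tau> / (32 * real N)) / 6"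
    define R2 where "R2 = cd / 2 * h / 6"
    have "ennreal R1 \<le> ?sup" unfolding R1_def
      using \<tau> \<tau>N by (intro weights_lower_bound[OF A0 _ _ _ K i d cd lower est]) auto
    moreover have "ennreal R2 \<le> ?sup" unfolding R2_def
      using \<tau> h Kp by (intro topic_lower_bound[OF _ Kp K i pos(2) _ d cd lower est]) (auto simp: L_def)
    moreover have "1 / 300 * cd * (X1 + X2) \<le> max R1 R2"
    proof -
      have R2: "cd * X2 / 96 \<le> R2"
        using mult_left_mono[OF rate2, of "cd / 12"] cd by (simp add: R2_def)
      have X2: "0 \<le> cd * X2" using cd by (simp add: X2_def)
      show ?thesis
      proof (cases "kappa_bar \<tau> A0 \<le> 0")
        case True
        then have "X1 \<le> 0"
          unfolding X1_def by (intro mult_nonpos_nonneg) auto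
        then have "cd * X1 \<le> 0" using cd by (simp add: mult_nonneg_nonpos)
        then show ?thesis using R2 X2 by (simp add: distrib_left)
      next
        case False
        then have "cd * X1 / 144 \<le> R1"
          using mult_left_mono[OF rate1, of "cd * kappa_bar \<tau> A0 / 24"] cd
          by (simp add: R1_def X1_def)
        then show ?thesis using R2 X2 by (simp add: distrib_left max_def)
      qed
    qed
    moreover have "ennreal (max R1 R2) \<le> ?sup" if "ennreal R1 \<le> ?sup" "ennreal R2 \<le> ?sup"
      unfolding max_def using that by simp
    ultimately show "ennreal (1 / 300 * cd * (X1 + X2)) \<le> ?sup"
      by (blast intro: ennreal_leI order_trans)
  qed
qed simp_all

end
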